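(* Let $\mathcal K$ be a simplicial complex satisfying the standing assumptions, and identify $C^{q-1}(\mathcal K,\mathbb C)$ and $C_+^{q-1}(\mathcal K,\mathbb C)$ with subspaces of $\ell^2(\widehat K_{q-1})$ by sending $f$ to the function $s\mapsto f(\langle s\rangle)$. Let $D(G_q)$ be the discriminant of the modified S-quantum walk $G_q$. Then: (1) For $f\in C_+^{q-1}(\mathcal K,\mathbb C)$ we have $D(G_q)f=-f$. (2) $C^{q-1}(\mathcal K,\mathbb C)$ is an invariant subspace of $D(G_q)$. For $f\in C^{q-1}(\mathcal K,\mathbb C)$ we have $$(I-D(G_q))f=\frac{2q}{q+1}\,(I-D_{q-1}^{\mathrm{up}})f.$$
   Context: Complexes. $\mathcal K=(V,\mathcal S)$ is an abstract simplicial complex: $V$ is a countable set, $\mathcal S$ is a family of finite subsets of $V$ closed under taking subsets, containing $\emptyset$ and all singletons. $\mathcal S_q$ is the set of simplices with $q+1$ elements (dimension $q$). Standing assumptions: (bounded degree) there is a constant $c$ such that every nonempty $F\in\mathcal S$ is contained in at most $c$ elements of $\mathcal S$; (finite dimension) $\dim\mathcal K:=\max\{\dim F: F\in\mathcal S\}<\infty$; (pure) every simplex is contained in a simplex of dimension $\dim\mathcal K$; (strongly connected) any two $\sigma_1,\sigma_2\in\mathcal S_{\dim\mathcal K}$ are joined by a sequence $\sigma_1=\tau_1,\dots,\tau_m=\sigma_2$ in $\mathcal S_{\dim\mathcal K}$ with $\tau_i\cap\tau_{i+1}\in\mathcal S_{\dim\mathcal K-1}$. Up discriminants $D_p^{\mathrm{up}}$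 are defined for $0\le p\le\dim\mathcal K-1$. Orientations. $\widehat K_q$ is the set of sequences $s=(a_0\cdots a_q)$ with $\{a_0,\dots,a_q\}\in\mathcal S_q$; the symmetric group $\mathfrak S_{q+1}$ (permutations of $\{0,\dots,q\}$) acts by $s^\pi=(a_{\pi(0)}\cdots a_{\pi(q)})$. $K_q=\widehat K_q/\mathfrak A_{q+1}$ ($\mathfrak A_{q+1}$ the alternating group) is the set of oriented $q$-simplices; the class of $s$ is $\langle s\rangle$. The group $\mathfrak S_{q+1}/\mathfrak A_{q+1}\cong\mathbb Z_2$ acts on $K_q$; this action is written $\tau\mapsto\overline\tau$, and $\overline\tau$ has the orientation opposite to $\tau$. $[\tau]\in\mathcal S_q$ denotes the underlying simplex of $\tau$. For $\sigma=\langle a_0\cdots a_q\rangle\in K_q$ and $\tau\in K_{q-1}$: $\mathrm{sgn}(\sigma,\tau)=(-1)^j$ if $\tau=\langle a_0\cdots\widehat{a_j}\cdots a_q\rangle$; $\mathrm{sgn}(\sigma,\tau)=0$ if $[\tau]$ is not a face of $[\sigma]$; and $\mathrm{sgn}(\sigma,\overline\tau)=\mathrm{sgn}(\overline\sigma,\tau)=-\mathrm{sgn}(\sigma,\tau)$. Function spaces. $C^q(\mathcal K,\mathbb C)=\{f\in\ell^2(K_q): f(\overline\tau)=-f(\tau)\}\cong\{f\in\ell^2(\widehat K_q): f(s^\pi)=\mathrm{sgn}(\pi)f(s)\}$ and $C^q_+(\mathcal K,\mathbb C)=\{f\in\ell^2(K_q): f(\overline\tau)=f(\tau)\}\cong\{f\in\ell^2(\widehat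 K_q): f(s^\pi)=f(s)\}$. Modified S-quantum walk. Let $\nu_q:\widehat K_q\to\widehat K_{q-1}$, $\nu_q(a_0\cdots a_{q-1}a_q)=(a_0\cdots a_{q-1})$, and for $t\in\widehat K_{q-1}$ let $\deg(t)=\#\nu_q^{-1}(t)$. Define $\widehat\alpha_{q-1}:\ell^2(\widehat K_{q-1})\to\ell^2(\widehat K_q)$ by $(\widehat\alpha_{q-1}f)(s)=\deg(\nu_q(s))^{-1/2}f(\nu_q(s))$, and $(\widehat P_qf)(s)=\frac1{(q+1)!}\sum_{\pi\in\mathfrak S_{q+1}}\mathrm{sgn}(\pi)f(s^\pi)$ on $\ell^2(\widehat K_q)$. Put $C_q=2\widehat\alpha_{q-1}\widehat\alpha_{q-1}^*-I$, $S_q=2\widehat P_q-I$, $G_q=S_qC_q$, and $D(G_q)=\widehat\alpha_{q-1}^*G_q\widehat\alpha_{q-1}=\widehat\alpha_{q-1}^*S_q\widehat\alpha_{q-1}$ on $\ell^2(\widehat K_{q-1})$. Up discriminant. $[\tau_1],[\tau_2]\in\mathcal S_p$ are up neighbors if both are contained in a common $(p+1)$-simplex. $E(X_p)$ is the set of $(\tau_1,\tau_2)\in K_p\times K_p$ with $\tau_1\ne\tau_2$, $\tau_1\ne\overline{\tau_2}$ and $[\tau_1],[\tau_2]$ up neighbors; for such a pair $\eta^{\mathrm{up}}(\tau_1,\tau_2)=\mathrm{sgn}(\sigma,\tau_1)\mathrm{sgn}(\sigma,\tau_2)$, where $\sigma\in K_{p+1}$ is either orientation of the unique common $(p+1)$-simplex.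 $\deg_X(\tau)$ is the number of $(p+1)$-simplices containing $[\tau]$. On $\ell^2(K_p)$, $$(D_p^{\mathrm{up}}g)(\tau)=\sum_{\tau'\in K_p:\,(\tau,\tau')\in E(X_p)}\frac{\eta^{\mathrm{up}}(\tau,\tau')g(\tau')}{\sqrt{2(p+1)\deg_X(\tau)}\sqrt{2(p+1)\deg_X(\tau')}}.$$ It maps $C^p(\mathcal K,\mathbb C)$ to itself.
   Formalization: Part (1) is stated only for q ≥ 2: for q = 1, C_+^0 is identified with all of ℓ²(V) and the claim fails (on a single edge {a,b}, (D(G_1)f)(a) = -f(b)); vertices are given two formal orientations so that (2) makes sense for q = 1. *)

theory Defs
  imports
    "HOL-Analysis.Analysis"
    "HOL-Combinatorics.Multiset_Permutations"
    "HOL-Library.Function_Algebras"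
begin

section \<open>Simplicial complexes\<close>

definition abstract_simplicial_complex :: "'a set \<Rightarrow> 'a set set \<Rightarrow> bool" where
  "abstract_simplicial_complex V S \<longleftrightarrow>
     countable V \<and>
     (\<forall>F\<in>S. finite F \<and> F \<subseteq> V) \<and>
     (\<forall>F\<in>S. \<forall>G. G \<subseteq> F \<longrightarrow> G \<in> S) \<and>
     {} \<in> S \<and> (\<forall>v\<in>V. {v} \<in> S)"

definition simplex_dim :: "'a set \<Rightarrow> int" where
  "simplex_dim F = int (card F) - 1"

definition simplices :: "'a set set \<Rightarrow> int \<Rightarrow> 'a set set" where
  "simplices S q = {F \<in> S. simplex_dim F = q}"

definition bounded_degree :: "'a set set \<Rightarrow> bool" where
  "bounded_degree S \<longleftrightarrow>
     (\<exists>c::nat. \<forall>F\<in>S. F \<noteq> {} \<longrightarrow> finite {G \<in> S. F \<subseteq> G} \<and> card {G \<in> S. F \<subseteq> G} \<le> c)"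

definition finite_dimensional :: "'a set set \<Rightarrow> bool" where
  "finite_dimensional S \<longleftrightarrow> finite (simplex_dim ` S)"

definition complex_dim :: "'a set set \<Rightarrow> int" where
  "complex_dim S = Max (simplex_dim ` S)"

definition pure :: "'a set set \<Rightarrow> bool" where
  "pure S \<longleftrightarrow> (\<forall>F\<in>S. \<exists>G\<in>simplices S (complex_dim S). F \<subseteq> G)"

definition strongly_connected :: "'a set set \<Rightarrow> bool" where
  "strongly_connected S \<longleftrightarrow>
     (\<forall>F\<in>simplices S (complex_dim S). \<forall>G\<in>simplices S (complex_dim S).
        \<exists>ts. ts \<noteq> [] \<and> hd ts = F \<and> last ts = G \<and>
             set ts \<subseteq> simplices S (complex_dim S) \<and>
             (\<forall>i. Suc i < length ts \<longrightarrow> ts ! i \<inter> ts ! Suc i \<in> simplices S (complex_dim S - 1)))"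


section \<open>Ordered and oriented simplices\<close>

text \<open>The set \<open>\<widehat>K\<^sub>q\<close>. A list of length \<open>q + 1\<close> whose set of entries has \<open>q + 1\<close> elements is
  automatically distinct. The action \<open>s\<^sup>\<pi>\<close> is \<^const>\<open>permute_list\<close>, with \<open>\<pi>\<close> permuting \<open>{..<q + 1}\<close>.\<close>

definition ordered_simplices :: "'a set set \<Rightarrow> nat \<Rightarrow> 'a list set" where
  "ordered_simplices S q = {s. length s = q + 1 \<and> set s \<in> simplices S (int q)}"

text \<open>An oriented simplex is a pair \<open>(F, A)\<close>: the underlying simplex \<open>F\<close> and an orbit \<open>A\<close> of the
  alternating group on the orderings of \<open>F\<close>. The opposite orientation is the complementary set of
  orderings of \<open>F\<close>; for \<open>q \<ge> 1\<close> it is the other orbit, see \<open>opposite_orientation_odd\<close> below, and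
  \<open>F\<close> is determined by \<open>A\<close>, so that this is the quotient of \<open>\<widehat>K\<^sub>q\<close> by the alternating group. For
  \<open>q = 0\<close> the group of all permutations is trivial, and the opposite orientation of a vertex has to
  be added formally; here it becomes \<open>({v}, {})\<close>, the first component recording the vertex.\<close>

type_synonym 'a oriented = "'a set \<times> 'a list set"

definition orient :: "'a list \<Rightarrow> 'a oriented" where
  "orient s = (set s, {permute_list \<pi> s | \<pi>. \<pi> permutes {..<length s} \<and> evenperm \<pi>})"

definition opposite_orientation :: "'a oriented \<Rightarrow> 'a oriented" where
  "opposite_orientation \<tau> = (fst \<tau>, permutations_of_set (fst \<tau>) - snd \<tau>)"

definition oriented_simplices :: "'a set set \<Rightarrow> nat \<Rightarrow> 'a oriented set" where
  "oriented_simplices S q =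
     orient ` ordered_simplices S q \<union> opposite_orientation ` orient ` ordered_simplices S q"

abbreviation underlying :: "'a oriented \<Rightarrow> 'a set" where
  "underlying \<equiv> fst"

lemma opposite_orientation_odd:
  assumes "distinct s" "\<pi> permutes {..<length s}" "\<not> evenperm \<pi>"
  shows "opposite_orientation (orient s) = orient (permute_list \<pi> s)"
proof -
  have perm: "permutation \<rho>" if "\<rho> permutes {..<length s}" for \<rho>
    using that permutation_permutes by blast
  have par: "evenperm (\<pi> \<circ> \<rho>) \<longleftrightarrow> \<not> evenperm \<rho>" if "\<rho> permutes {..<length s}" for \<rho>
    using evenperm_comp[OF perm[OF assms(2)] perm[OF that]] assms(3) by simp
  have comp: "permute_list \<rho> (permute_list \<pi> s) = permute_list (\<pi> \<circ> \<rho>) s"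
    if "\<rho> permutes {..<length s}" for \<rho>
    using permute_list_compose[OF that] by simp
  have inj: "\<rho> = \<rho>'" if "permute_list \<rho> s = permute_list \<rho>' s"
    "\<rho> permutes {..<length s}" "\<rho>' permutes {..<length s}" for \<rho> \<rho>'
  proof
    fix i
    show "\<rho> i = \<rho>' i"
    proof (cases "i < length s")
      case True
      then have "s ! \<rho> i = s ! \<rho>' i"
        using permute_list_nth[OF that(2) True] permute_list_nth[OF that(3) True] that(1) by simp
      moreover have "\<rho> i < length s" "\<rho>' i < length s"
        using True permutes_in_image[OF that(2), of i] permutes_in_image[OF that(3), of i] by simp_all
      ultimately show ?thesis
        using assms(1) nth_eq_iff_index_eq by blast
    next
      case False
      then show ?thesis using permutes_not_in[OF that(2)] permutes_not_in[OF that(3)] by simp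
    qed
  qed
  let ?E = "{permute_list \<rho> s | \<rho>. \<rho> permutes {..<length s} \<and> evenperm \<rho>}"
  let ?O = "{permute_list \<rho> (permute_list \<pi> s) | \<rho>. \<rho> permutes {..<length s} \<and> evenperm \<rho>}"
  have "permutations_of_set (set s) - ?E = ?O"
  proof (intro equalityI subsetI)
    fix x assume x: "x \<in> permutations_of_set (set s) - ?E"
    then have "mset s = mset x"
      using assms(1) set_eq_iff_mset_eq_distinct[of s x] permutations_of_setD[of x "set s"] by blast
    then obtain \<sigma> where \<sigma>: "\<sigma> permutes {..<length s}" "permute_list \<sigma> s = x"
      using mset_eq_permutation by metis
    let ?\<rho> = "inv \<pi> \<circ> \<sigma>"
    have \<rho>: "?\<rho> permutes {..<length s}"
      using permutes_compose[OF \<sigma>(1) permutes_inv[OF assms(2)]] .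
    have eq: "\<pi> \<circ> ?\<rho> = \<sigma>"
      using assms(2) by (simp add: o_assoc permutes_inv_o)
    have "\<not> evenperm \<sigma>" using x \<sigma> by blast
    then have "evenperm ?\<rho>" using par[OF \<rho>] unfolding eq by simp
    moreover have "x = permute_list ?\<rho> (permute_list \<pi> s)"
      using comp[OF \<rho>] \<sigma>(2) unfolding eq by simp
    ultimately show "x \<in> ?O" using \<rho> by blast
  next
    fix x assume "x \<in> ?O"
    then obtain \<rho> where \<rho>: "\<rho> permutes {..<length s}" "evenperm \<rho>"
      "x = permute_list \<rho> (permute_list \<pi> s)" by blast
    have c: "\<pi> \<circ> \<rho> permutes {..<length s}" using permutes_compose[OF \<rho>(1) assms(2)] .
    have x: "x = permute_list (\<pi> \<circ> \<rho>) s" using comp[OF \<rho>(1)] \<rho>(3) by simp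
    have "x \<notin> ?E"
    proof
      assume "x \<in> ?E"
      then obtain \<rho>' where \<rho>': "x = permute_list \<rho>' s" "\<rho>' permutes {..<length s}" "evenperm \<rho>'"
        by blast
      have "\<rho>' = \<pi> \<circ> \<rho>" using inj[OF _ \<rho>'(2) c] \<rho>'(1) x by simp
      then show False using par[OF \<rho>(1)] \<rho>(2) \<rho>'(3) by simp
    qed
    moreover have "x \<in> permutations_of_set (set s)"
      using assms(1) c x by (simp add: permutations_of_set_def)
    ultimately show "x \<in> permutations_of_set (set s) - ?E" by blast
  qed
  then show ?thesis
    unfolding opposite_orientation_def orient_def fst_conv snd_conv
      length_permute_list set_permute_list[OF assms(2)] by simp
qed

lemma oriented_simplices_eq:
  assumes "q \<ge> 1"
  shows "oriented_simplices S q = orient ` ordered_simplices S q"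
proof -
  have "opposite_orientation (orient s) \<in> orient ` ordered_simplices S q"
    if s: "s \<in> ordered_simplices S q" for s
  proof -
    have len: "length s = q + 1" using s by (simp add: ordered_simplices_def)
    have dist: "distinct s"
      using s by (intro card_distinct)
        (simp add: ordered_simplices_def simplices_def simplex_dim_def)
    let ?\<pi> = "Transposition.transpose (0::nat) 1"
    have p: "?\<pi> permutes {..<length s}"
      using len assms by (intro permutes_swap_id) auto
    have "permute_list ?\<pi> s \<in> ordered_simplices S q"
      using s p by (simp add: ordered_simplices_def)
    moreover have "opposite_orientation (orient s) = orient (permute_list ?\<pi> s)"
      by (rule opposite_orientation_odd[OF dist p]) (metis evenperm_swap zero_neq_one)
    ultimately show ?thesis by blast
  qed
  then show ?thesis unfolding oriented_simplices_def by blast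
qed

text \<open>The rules determining \<open>sgn(\<sigma>, \<tau>)\<close> for \<open>[\<tau>]\<close> a face of \<open>[\<sigma>]\<close>.\<close>

inductive incidence :: "'a oriented \<Rightarrow> 'a oriented \<Rightarrow> int \<Rightarrow> bool" where
  delete: "distinct s \<Longrightarrow> j < length s \<Longrightarrow>
     incidence (orient s) (orient (take j s @ drop (Suc j) s)) ((-1) ^ j)"
| opp_face: "incidence \<sigma> \<tau> c \<Longrightarrow> incidence \<sigma> (opposite_orientation \<tau>) (- c)"
| opp_simplex: "incidence \<sigma> \<tau> c \<Longrightarrow> incidence (opposite_orientation \<sigma>) \<tau> (- c)"

definition incidence_sign :: "'a oriented \<Rightarrow> 'a oriented \<Rightarrow> int" where
  "incidence_sign \<sigma> \<tau> =
     (if underlying \<tau> \<subseteq> underlying \<sigma> then (THE c. incidence \<sigma> \<tau> c) else 0)"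


section \<open>Function spaces\<close>

text \<open>Elements of \<open>\<ell>\<^sup>2(X)\<close> are functions on the whole type that vanish outside \<open>X\<close>.\<close>

definition ell2 :: "'b set \<Rightarrow> ('b \<Rightarrow> complex) set" where
  "ell2 X = {f. (\<forall>x. x \<notin> X \<longrightarrow> f x = 0) \<and> (\<lambda>x. (cmod (f x))\<^sup>2) summable_on X}"

definition ell2_inner :: "'b set \<Rightarrow> ('b \<Rightarrow> complex) \<Rightarrow> ('b \<Rightarrow> complex) \<Rightarrow> complex" where
  "ell2_inner X f g = (\<Sum>\<^sub>\<infinity>x\<in>X. f x * cnj (g x))"

definition ell2_adjoint ::
  "'b set \<Rightarrow> 'c set \<Rightarrow> (('b \<Rightarrow> complex) \<Rightarrow> ('c \<Rightarrow> complex)) \<Rightarrow> ('c \<Rightarrow> complex) \<Rightarrow> ('b \<Rightarrow> complex)" where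
  "ell2_adjoint X Y T g =
     (THE h. h \<in> ell2 X \<and> (\<forall>f\<in>ell2 X. ell2_inner Y (T f) g = ell2_inner X f h))"

definition cochains :: "'a set set \<Rightarrow> nat \<Rightarrow> ('a oriented \<Rightarrow> complex) set" where
  "cochains S q = {f \<in> ell2 (oriented_simplices S q).
     \<forall>\<tau>\<in>oriented_simplices S q. f (opposite_orientation \<tau>) = - f \<tau>}"

text \<open>For \<open>q = 0\<close> the condition below still allows every function on the vertices, and lifting it to
  \<open>\<widehat>K\<^sub>0\<close> gives the same space as lifting \<open>cochains S 0\<close>.\<close>

definition even_cochains :: "'a set set \<Rightarrow> nat \<Rightarrow> ('a oriented \<Rightarrow> complex) set" where
  "even_cochains S q = {f \<in> ell2 (oriented_simplices S q).
     \<forall>\<tau>\<in>oriented_simplices S q. f (opposite_orientation \<tau>) = f \<tau>}"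

definition lift_ordered ::
  "'a set set \<Rightarrow> nat \<Rightarrow> ('a oriented \<Rightarrow> complex) \<Rightarrow> ('a list \<Rightarrow> complex)" where
  "lift_ordered S q f = (\<lambda>s. if s \<in> ordered_simplices S q then f (orient s) else 0)"

definition complex_subspace :: "('b \<Rightarrow> complex) set \<Rightarrow> bool" where
  "complex_subspace = module.subspace (\<lambda>(c::complex) f x. c * f x)"

definition invariant_subspace ::
  "('b \<Rightarrow> complex) set \<Rightarrow> (('b \<Rightarrow> complex) \<Rightarrow> ('b \<Rightarrow> complex)) \<Rightarrow> ('b \<Rightarrow> complex) set \<Rightarrow> bool" where
  "invariant_subspace H T W \<longleftrightarrow> W \<subseteq> H \<and> complex_subspace W \<and> (\<forall>f\<in>W. T f \<in> W)"


section \<open>The modified S-quantum walk\<close>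

text \<open>The map \<open>\<nu>\<^sub>q\<close> is \<^const>\<open>butlast\<close>.\<close>

definition ordered_degree :: "'a set set \<Rightarrow> nat \<Rightarrow> 'a list \<Rightarrow> nat" where
  "ordered_degree S p t = card {s \<in> ordered_simplices S (Suc p). butlast s = t}"

definition walk_alpha :: "'a set set \<Rightarrow> nat \<Rightarrow> ('a list \<Rightarrow> complex) \<Rightarrow> ('a list \<Rightarrow> complex)" where
  "walk_alpha S p f = (\<lambda>s. if s \<in> ordered_simplices S (Suc p)
     then of_real (1 / sqrt (real (ordered_degree S p (butlast s)))) * f (butlast s) else 0)"

definition walk_alpha_adj :: "'a set set \<Rightarrow> nat \<Rightarrow> ('a list \<Rightarrow> complex) \<Rightarrow> ('a list \<Rightarrow> complex)" where
  "walk_alpha_adj S p =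
     ell2_adjoint (ordered_simplices S p) (ordered_simplices S (Suc p)) (walk_alpha S p)"

definition antisymmetrizer :: "'a set set \<Rightarrow> nat \<Rightarrow> ('a list \<Rightarrow> complex) \<Rightarrow> ('a list \<Rightarrow> complex)" where
  "antisymmetrizer S q f = (\<lambda>s. if s \<in> ordered_simplices S q
     then 1 / fact (q + 1) * (\<Sum>\<pi> | \<pi> permutes {..<q + 1}. of_int (sign \<pi>) * f (permute_list \<pi> s))
     else 0)"

definition walk_coin :: "'a set set \<Rightarrow> nat \<Rightarrow> ('a list \<Rightarrow> complex) \<Rightarrow> ('a list \<Rightarrow> complex)" where
  "walk_coin S q f = (\<lambda>s. 2 * walk_alpha S (q - 1) (walk_alpha_adj S (q - 1) f) s - f s)"

definition walk_shift :: "'a set set \<Rightarrow> nat \<Rightarrow> ('a list \<Rightarrow> complex) \<Rightarrow> ('a list \<Rightarrow> complex)" where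
  "walk_shift S q f = (\<lambda>s. 2 * antisymmetrizer S q f s - f s)"

definition modified_walk :: "'a set set \<Rightarrow> nat \<Rightarrow> ('a list \<Rightarrow> complex) \<Rightarrow> ('a list \<Rightarrow> complex)" where
  "modified_walk S q f = walk_shift S q (walk_coin S q f)"

definition walk_discriminant :: "'a set set \<Rightarrow> nat \<Rightarrow> ('a list \<Rightarrow> complex) \<Rightarrow> ('a list \<Rightarrow> complex)" where
  "walk_discriminant S q f =
     walk_alpha_adj S (q - 1) (modified_walk S q (walk_alpha S (q - 1) f))"


section \<open>The up discriminant\<close>

definition up_neighbors :: "'a set set \<Rightarrow> nat \<Rightarrow> 'a set \<Rightarrow> 'a set \<Rightarrow> bool" where
  "up_neighbors S p F G \<longleftrightarrow> (\<exists>H\<in>simplices S (int p + 1). F \<subseteq> H \<and> G \<subseteq> H)"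

definition up_edges :: "'a set set \<Rightarrow> nat \<Rightarrow> ('a oriented \<times> 'a oriented) set" where
  "up_edges S p = {(\<tau>\<^sub>1, \<tau>\<^sub>2) \<in> oriented_simplices S p \<times> oriented_simplices S p.
     \<tau>\<^sub>1 \<noteq> \<tau>\<^sub>2 \<and> \<tau>\<^sub>1 \<noteq> opposite_orientation \<tau>\<^sub>2 \<and> up_neighbors S p (underlying \<tau>\<^sub>1) (underlying \<tau>\<^sub>2)}"

text \<open>The common \<open>(p + 1)\<close>-simplex of a pair in \<open>up_edges S p\<close> is unique, and the product of signs
  does not depend on which of its two orientations is selected.\<close>

definition up_sign :: "'a set set \<Rightarrow> nat \<Rightarrow> 'a oriented \<Rightarrow> 'a oriented \<Rightarrow> int" where
  "up_sign S p \<tau>\<^sub>1 \<tau>\<^sub>2 =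
     (let \<sigma> = (SOME \<sigma>. \<sigma> \<in> oriented_simplices S (Suc p) \<and>
                       underlying \<tau>\<^sub>1 \<subseteq> underlying \<sigma> \<and> underlying \<tau>\<^sub>2 \<subseteq> underlying \<sigma>)
      in incidence_sign \<sigma> \<tau>\<^sub>1 * incidence_sign \<sigma> \<tau>\<^sub>2)"

definition up_degree :: "'a set set \<Rightarrow> nat \<Rightarrow> 'a oriented \<Rightarrow> nat" where
  "up_degree S p \<tau> = card {H \<in> simplices S (int p + 1). underlying \<tau> \<subseteq> H}"

definition up_discriminant ::
  "'a set set \<Rightarrow> nat \<Rightarrow> ('a oriented \<Rightarrow> complex) \<Rightarrow> ('a oriented \<Rightarrow> complex)" where
  "up_discriminant S p g = (\<lambda>\<tau>. \<Sum>\<tau>' | (\<tau>, \<tau>') \<in> up_edges S p.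
     of_int (up_sign S p \<tau> \<tau>') * g \<tau>' /
     of_real (sqrt (2 * (real p + 1) * real (up_degree S p \<tau>)) *
              sqrt (2 * (real p + 1) * real (up_degree S p \<tau>'))))"

end

theory Submission
  imports Defs
begin

text \<open>
  Write \<open>p = q - 1\<close>. The map \<open>\<alpha>\<close> is an isometry, so \<open>D f = 2 \<alpha>\<^sup>* P \<alpha> f - f\<close>, and everything
  reduces to computing \<open>P \<alpha> f\<close>. If \<open>f\<close> is symmetric and \<open>q \<ge> 2\<close>, then \<open>\<alpha> f\<close> is invariant under the
  transposition of the first two entries, so \<open>P \<alpha> f = 0\<close>. If \<open>f\<close> is antisymmetric, split the sum over
  the permutations of \<open>s = t @ [v]\<close> according to the entry moved to the end: writing a permutation as
  the transposition of the last position with some position \<open>j\<close> followed by a permutation of the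
  first \<open>q\<close> positions, all terms with the same \<open>j\<close> agree, and the term for \<open>j\<close> involves the simplex
  \<open>t[j := v]\<close> in which \<open>v\<close> replaces the entry \<open>t ! j\<close>. These simplices, with their two orientations,
  are exactly the up neighbours of \<open>t\<close>, with sign \<open>-1\<close> relative to the simplex \<open>t @ [v]\<close>.
\<close>

section \<open>Orientations and incidence signs\<close>

lemma ordered_simplices_iff:
  "s \<in> ordered_simplices S k \<longleftrightarrow> length s = Suc k \<and> distinct s \<and> set s \<in> S"
  unfolding ordered_simplices_def simplices_def simplex_dim_def
  using card_distinct[of s] distinct_card[of s] by auto

text \<open>An orientation is treated as a reference ordering together with a parity bit. Flips then
  compose by exclusive or, and comparing orientations of one simplex becomes Boolean
  arithmetic.\<close>

definition flip :: "bool \<Rightarrow> 'a oriented \<Rightarrow> 'a oriented" where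
  "flip b \<tau> = (if b then opposite_orientation \<tau> else \<tau>)"

lemma fst_orient [simp]: "fst (orient s) = set s"
  by (simp add: orient_def)

lemma fst_opposite [simp]: "fst (opposite_orientation \<tau>) = fst \<tau>"
  by (simp add: opposite_orientation_def)

lemma fst_flip [simp]: "fst (flip b \<tau>) = fst \<tau>"
  by (simp add: flip_def)

lemma self_in_orient: "s \<in> snd (orient s)"
  unfolding orient_def by (auto intro!: exI[of _ id] simp: permutes_id)

lemma orient_subset_permutations:
  "distinct s \<Longrightarrow> snd (orient s) \<subseteq> permutations_of_set (set s)"
  by (auto simp: orient_def permutations_of_set_def)

text \<open>For distinct \<open>s\<close> the class lies inside \<open>permutations_of_set\<close>,
  so complementing twice in that set restores it.\<close>

lemma opposite_opposite:
  "distinct s \<Longrightarrow> opposite_orientation (opposite_orientation (orient s)) = orient s"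
  using orient_subset_permutations[of s]
  by (auto simp: opposite_orientation_def prod_eq_iff)

text \<open>The list \<open>s\<close> lies in its own class and so not in the complement. This
  separates the two orientations of a single vertex as well, where the opposite class is
  empty.\<close>

lemma opposite_neq: "opposite_orientation (orient s) \<noteq> orient s"
  using self_in_orient[of s] by (auto simp: opposite_orientation_def prod_eq_iff)

lemma flip_flip: "distinct s \<Longrightarrow> flip b (flip c (orient s)) = flip (b \<noteq> c) (orient s)"
  by (auto simp: flip_def opposite_opposite)

lemma flip_eq_iff: "flip b (orient s) = flip c (orient s) \<longleftrightarrow> b = c"
  using opposite_neq[of s] by (auto simp: flip_def)

lemma flip_False [simp]: "flip False \<tau> = \<tau>"
  by (simp add: flip_def)

text \<open>The odd case is \<open>opposite_orientation_odd\<close>. For even \<open>\<pi>\<close>,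
  composing with \<open>\<pi>\<close> on the left maps the alternating group onto itself, so the
  orbit does not change.\<close>

lemma orient_permute:
  assumes "distinct s" "\<pi> permutes {..<length s}"
  shows "orient (permute_list \<pi> s) = flip (\<not> evenperm \<pi>) (orient s)"
proof (cases "evenperm \<pi>")
  case False
  then show ?thesis using opposite_orientation_odd[OF assms] by (simp add: flip_def)
next
  case True
  have perm: "permutation \<rho>" if "\<rho> permutes {..<length s}" for \<rho>
    using that permutation_permutes by blast
  have comp: "permute_list \<rho> (permute_list \<pi> s) = permute_list (\<pi> \<circ> \<rho>) s"
    if "\<rho> permutes {..<length s}" for \<rho>
    using permute_list_compose[OF that] by simp
  have "{permute_list \<rho> (permute_list \<pi> s) |\<rho>. \<rho> permutes {..<length s} \<and> evenperm \<rho>} =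
    {permute_list \<rho> s |\<rho>. \<rho> permutes {..<length s} \<and> evenperm \<rho>}" (is "?A = ?B")
  proof (intro equalityI subsetI)
    fix x assume "x \<in> ?A"
    then obtain \<rho> where \<rho>: "x = permute_list \<rho> (permute_list \<pi> s)" "\<rho> permutes {..<length s}"
      "evenperm \<rho>" by blast
    have "evenperm (\<pi> \<circ> \<rho>)"
      using evenperm_comp[OF perm[OF assms(2)] perm[OF \<rho>(2)]] True \<rho>(3) by simp
    then show "x \<in> ?B"
      using comp[OF \<rho>(2)] \<rho>(1) permutes_compose[OF \<rho>(2) assms(2)] by auto
  next
    fix x assume "x \<in> ?B"
    then obtain \<rho> where \<rho>: "x = permute_list \<rho> s" "\<rho> permutes {..<length s}" "evenperm \<rho>"
      by blast
    let ?\<rho> = "inv \<pi> \<circ> \<rho>"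
    have inv: "inv \<pi> permutes {..<length s}" using permutes_inv[OF assms(2)] .
    have "?\<rho> permutes {..<length s}" using permutes_compose[OF \<rho>(2) inv] .
    moreover have "evenperm ?\<rho>"
      using evenperm_comp[OF perm[OF inv] perm[OF \<rho>(2)]] evenperm_inv[OF perm[OF assms(2)]]
        True \<rho>(3) by simp
    moreover have "\<pi> \<circ> ?\<rho> = \<rho>" using assms(2) by (simp add: o_assoc permutes_inv_o)
    ultimately show "x \<in> ?A" using comp[of ?\<rho>] \<rho>(1) by force
  qed
  then show ?thesis
    using True assms(2) by (simp add: orient_def flip_def)
qed

section \<open>Reordering a simplex and moving a vertex to the end\<close>

lemma permute_list_snoc:
  assumes "\<pi> permutes {..<length t}"
  shows "permute_list \<pi> (t @ [x]) = permute_list \<pi> t @ [x]"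
proof (rule nth_equalityI)
  have p: "\<pi> permutes {..<length (t @ [x])}"
    using permutes_subset[OF assms] by auto
  fix i assume i: "i < length (permute_list \<pi> (t @ [x]))"
  show "permute_list \<pi> (t @ [x]) ! i = (permute_list \<pi> t @ [x]) ! i"
  proof (cases "i < length t")
    case True
    then have "\<pi> i < length t" using permutes_in_image[OF assms, of i] by simp
    then show ?thesis
      using True permute_list_nth[OF p] permute_list_nth[OF assms] by (simp add: nth_append)
  next
    case False
    then show ?thesis
      using i permute_list_nth[OF p, of i] permutes_not_in[OF assms, of i] by (simp add: nth_append)
  qed
qed simp

text \<open>A permutation carrying \<open>t\<close> to \<open>s\<close> fixes the appended last
  position and keeps its parity, so one bit \<open>b\<close> serves the face and all its one-vertex
  extensions. This common bit is what cancels in incidence signs.\<close>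

lemma orient_reorder:
  assumes "distinct s" "distinct t" "set s = set t"
  shows "\<exists>b. orient s = flip b (orient t) \<and>
    (\<forall>x. x \<notin> set t \<longrightarrow> orient (s @ [x]) = flip b (orient (t @ [x])))"
proof -
  have "mset t = mset s"
    using assms set_eq_iff_mset_eq_distinct by blast
  then obtain \<pi> where \<pi>: "\<pi> permutes {..<length t}" "permute_list \<pi> t = s"
    using mset_eq_permutation by metis
  have "orient s = flip (\<not> evenperm \<pi>) (orient t)"
    using orient_permute[OF assms(2) \<pi>(1)] \<pi>(2) by simp
  moreover have "orient (s @ [x]) = flip (\<not> evenperm \<pi>) (orient (t @ [x]))" if "x \<notin> set t" for x
  proof -
    have "\<pi> permutes {..<length (t @ [x])}"
      using permutes_subset[OF \<pi>(1)] by auto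
    then show ?thesis
      using orient_permute[of "t @ [x]" \<pi>] permute_list_snoc[OF \<pi>(1), of x] assms(2) that \<pi>(2)
      by simp
  qed
  ultimately show ?thesis by blast
qed

lemma oriented_simplices_iff:
  "\<tau> \<in> oriented_simplices S k \<longleftrightarrow> (\<exists>s\<in>ordered_simplices S k. \<exists>b. \<tau> = flip b (orient s))"
  unfolding oriented_simplices_def flip_def by (auto simp: ex_bool_eq)

lemma oriented_simplex_cases:
  assumes "\<tau> \<in> oriented_simplices S k" "distinct t" "set t = fst \<tau>"
  obtains b where "\<tau> = flip b (orient t)"
proof -
  obtain s c where s: "s \<in> ordered_simplices S k" "\<tau> = flip c (orient s)"
    using assms(1) oriented_simplices_iff by blast
  then have "distinct s" "set s = set t" using assms(3) by (auto simp: ordered_simplices_iff)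
  then obtain b where b: "orient s = flip b (orient t)"
    using orient_reorder[OF _ assms(2)] by blast
  have "\<tau> = flip (c \<noteq> b) (orient t)"
    using s(2) unfolding b flip_flip[OF assms(2)] .
  then show thesis by (rule that)
qed

text \<open>Swapping the last position with \<open>j\<close> puts \<open>v\<close> in place of
  \<open>t ! j\<close> and saves the displaced vertex at the end. The sum over permutations and the
  signs of up neighbours both rest on this form.\<close>

lemma permute_list_transpose_last:
  assumes "j < length t"
  shows "permute_list (Transposition.transpose (length t) j) (t @ [v]) = t[j := v] @ [t ! j]"
proof (rule nth_equalityI)
  fix i assume "i < length (permute_list (Transposition.transpose (length t) j) (t @ [v]))"
  then have i: "i < Suc (length t)" by simp
  then have "permute_list (Transposition.transpose (length t) j) (t @ [v]) ! i =
    (t @ [v]) ! Transposition.transpose (length t) j i"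
    by (simp add: permute_list_def del: upt_Suc)
  moreover consider "i = length t" | "i = j" | "i < length t" "i \<noteq> j" using i by linarith
  then have "(t @ [v]) ! Transposition.transpose (length t) j i = (t[j := v] @ [t ! j]) ! i"
    by cases (use assms in \<open>simp_all add: nth_append\<close>)
  ultimately show "permute_list (Transposition.transpose (length t) j) (t @ [v]) ! i = (t[j := v] @ [t ! j]) ! i"
    by simp
qed simp

text \<open>Position \<open>j\<close> differs from the last one, so the transposition is odd. This
  is the origin of the minus sign between \<open>t\<close> and its exchanged simplex.\<close>

lemma orient_exchange:
  assumes "distinct (t @ [v])" "j < length t"
  shows "orient (t[j := v] @ [t ! j]) = flip True (orient (t @ [v]))"
proof -
  have p: "Transposition.transpose (length t) j permutes {..<length (t @ [v])}"
    using assms by (intro permutes_swap_id) auto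
  show ?thesis
    using orient_permute[OF assms(1) p] assms(2)
    unfolding permute_list_transpose_last[OF assms(2)] by (simp add: evenperm_swap)
qed

lemma orient_swap_adjacent:
  assumes "distinct (a @ x # y # b)"
  shows "orient (a @ x # y # b) = flip True (orient (a @ y # x # b))"
proof -
  let ?n = "length a"
  have p: "Transposition.transpose ?n (Suc ?n) permutes {..<length (a @ y # x # b)}"
    by (intro permutes_swap_id) auto
  have "permute_list (Transposition.transpose ?n (Suc ?n)) (a @ y # x # b) = a @ x # y # b"
  proof (rule nth_equalityI)
    fix i assume "i < length (permute_list (Transposition.transpose ?n (Suc ?n)) (a @ y # x # b))"
    then have i: "i < length (a @ y # x # b)" by simp
    then have "permute_list (Transposition.transpose ?n (Suc ?n)) (a @ y # x # b) ! i =
      (a @ y # x # b) ! Transposition.transpose ?n (Suc ?n) i"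
      by (simp add: permute_list_def del: upt_Suc)
    moreover consider "i = ?n" | "i = Suc ?n" | "i < ?n" | "i > Suc ?n" by linarith
    then have "(a @ y # x # b) ! Transposition.transpose ?n (Suc ?n) i = (a @ x # y # b) ! i"
    proof cases
      case 4
      then obtain k where "i = Suc (Suc (?n + k))" using less_imp_Suc_add by blast
      then show ?thesis by (simp add: nth_append)
    qed (simp_all add: nth_append)
    ultimately show "permute_list (Transposition.transpose ?n (Suc ?n)) (a @ y # x # b) ! i =
      (a @ x # y # b) ! i" by simp
  qed simp
  then show ?thesis
    using orient_permute[OF _ p] assms by (auto simp: evenperm_swap)
qed

text \<open>Each entry of \<open>b\<close> is passed by one adjacent swap, so only the parity of the
  length of \<open>b\<close> survives.\<close>

lemma orient_move_to_end:
  assumes "distinct (a @ x # b)"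
  shows "orient (a @ x # b) = flip (odd (length b)) (orient (a @ b @ [x]))"
  using assms
proof (induction b arbitrary: a)
  case (Cons y b)
  have "orient (a @ x # y # b) = flip True (orient ((a @ [y]) @ x # b))"
    using orient_swap_adjacent[OF Cons.prems] by simp
  also have "orient ((a @ [y]) @ x # b) = flip (odd (length b)) (orient ((a @ [y]) @ b @ [x]))"
    using Cons.prems by (intro Cons.IH) auto
  finally show ?case
    using Cons.prems by (subst (asm) flip_flip) auto
qed simp

section \<open>Values of the incidence sign\<close>

lemma flip_opposite: "opposite_orientation (flip b (orient s)) = flip (\<not> b) (orient s)"
  if "distinct s"
  using that by (simp add: flip_def opposite_opposite)

text \<open>Moving the deleted vertex to the end replaces the position \<open>j\<close> by \<open>length t\<close>, so that the value
  depends only on the two orientations; hence the \<open>THE\<close> in \<^const>\<open>incidence_sign\<close> is well defined.\<close>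

lemma incidence_normal_form:
  assumes "incidence \<sigma> \<tau> c"
  shows "\<exists>t x b d. distinct (t @ [x]) \<and> \<sigma> = flip b (orient (t @ [x])) \<and> \<tau> = flip d (orient t) \<and>
    c = (if b = d then 1 else -1) * (-1) ^ length t"
  using assms
proof induction
  case (delete s j)
  define a b x where ab: "a = take j s" "b = drop (Suc j) s" "x = s ! j"
  have s: "s = a @ x # b" using delete ab id_take_nth_drop by blast
  have j: "j = length a" using delete ab by simp
  have "(-1) ^ j = (if odd (length b) = False then 1 else -1) * (-1::int) ^ length (a @ b)"
    by (simp add: j power_add)
  moreover have "orient s = flip (odd (length b)) (orient ((a @ b) @ [x]))"
    using orient_move_to_end[of a x b] delete s by simp
  moreover have "distinct ((a @ b) @ [x])" using delete s by auto
  moreover have "orient (take j s @ drop (Suc j) s) = flip False (orient (a @ b))"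
    by (simp add: ab)
  ultimately show ?case by blast
next
  case (opp_face \<sigma> \<tau> c)
  then obtain t x b d where *: "distinct (t @ [x])" "\<sigma> = flip b (orient (t @ [x]))"
    "\<tau> = flip d (orient t)" "c = (if b = d then 1 else -1) * (-1) ^ length t" by blast
  then have "opposite_orientation \<tau> = flip (\<not> d) (orient t)" "distinct t"
    using flip_opposite[of t] by auto
  moreover have "- c = (if b = (\<not> d) then 1 else -1) * (-1) ^ length t" using * by auto
  ultimately show ?case using * by blast
next
  case (opp_simplex \<sigma> \<tau> c)
  then obtain t x b d where *: "distinct (t @ [x])" "\<sigma> = flip b (orient (t @ [x]))"
    "\<tau> = flip d (orient t)" "c = (if b = d then 1 else -1) * (-1) ^ length t" by blast
  then have "opposite_orientation \<sigma> = flip (\<not> b) (orient (t @ [x]))"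
    using flip_opposite[of "t @ [x]"] by auto
  moreover have "- c = (if (\<not> b) = d then 1 else -1) * (-1) ^ length t" using * by auto
  ultimately show ?case using * by blast
qed

lemma incidence_flip:
  assumes "incidence \<sigma> \<tau> c"
  shows "incidence (flip b \<sigma>) (flip d \<tau>) ((if b = d then 1 else -1) * c)"
  using assms incidence.intros(2)[OF assms] incidence.intros(3)[OF assms]
    incidence.intros(3)[OF incidence.intros(2)[OF assms]]
  by (cases b; cases d) (simp_all add: flip_def)

text \<open>Deleting the last vertex gives one admissible value; the normal form shows that every
  derivation of \<open>incidence\<close> yields the same one, so \<open>THE\<close> can be
  evaluated.\<close>

lemma incidence_sign_snoc:
  assumes "distinct (t @ [x])"
  shows "incidence_sign (flip b (orient (t @ [x]))) (flip d (orient t)) =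
    (if b = d then 1 else -1) * (-1) ^ length t" (is "incidence_sign ?\<sigma> ?\<tau> = ?c")
proof -
  have "incidence (orient (t @ [x])) (orient t) ((-1) ^ length t)"
    using incidence.delete[of "t @ [x]" "length t"] assms by simp
  then have "incidence ?\<sigma> ?\<tau> ?c" by (rule incidence_flip)
  moreover have "c = ?c" if c: "incidence ?\<sigma> ?\<tau> c" for c
  proof -
    obtain t' x' b' d' where *: "distinct (t' @ [x'])" "?\<sigma> = flip b' (orient (t' @ [x']))"
      "?\<tau> = flip d' (orient t')" "c = (if b' = d' then 1 else -1) * (-1) ^ length t'"
      using incidence_normal_form[OF c] by blast
    have "fst ?\<tau> = fst (flip d' (orient t'))" using *(3) by simp
    then have set: "set t' = set t" by simp
    have "fst ?\<sigma> = fst (flip b' (orient (t' @ [x'])))" using *(2) by simp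
    \<comment> \<open>The deleted vertex is the one vertex of the simplex outside the face, so the
      underlying sets determine it.\<close>
    then have x: "x' = x" using set assms *(1) by auto
    have len: "length t' = length t"
      using set assms *(1) distinct_card[of t] distinct_card[of t'] by simp
    have dist: "distinct t" "distinct t'" "x \<notin> set t" using assms *(1) by auto
    \<comment> \<open>The pairs \<open>b\<close>, \<open>d\<close> and \<open>b'\<close>,
      \<open>d'\<close> differ by the same bit \<open>e\<close>, so \<open>b = d\<close> holds
      exactly when \<open>b' = d'\<close> does.\<close>
    then obtain e where e: "orient t' = flip e (orient t)"
      "orient (t' @ [x]) = flip e (orient (t @ [x]))"
      using orient_reorder[OF dist(2,1) set] by blast
    have "b = (b' \<noteq> e)"
      using *(2) unfolding x e(2) flip_flip[OF assms] flip_eq_iff .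
    moreover have "d = (d' \<noteq> e)"
      using *(3) unfolding e(1) flip_flip[OF dist(1)] flip_eq_iff .
    ultimately show ?thesis using *(4) len by auto
  qed
  ultimately have "(THE c. incidence ?\<sigma> ?\<tau> c) = ?c" by blast
  then show ?thesis by (auto simp: incidence_sign_def)
qed

section \<open>Square-summable functions and adjoints\<close>

lemma ell2D: "f \<in> ell2 X \<Longrightarrow> x \<notin> X \<Longrightarrow> f x = 0"
  and ell2_summable: "f \<in> ell2 X \<Longrightarrow> (\<lambda>x. (cmod (f x))\<^sup>2) summable_on X"
  by (auto simp: ell2_def)

lemma ell2I:
  "\<lbrakk>\<And>x. x \<notin> X \<Longrightarrow> f x = 0; (\<lambda>x. (cmod (f x))\<^sup>2) summable_on X\<rbrakk> \<Longrightarrow> f \<in> ell2 X"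
  by (auto simp: ell2_def)

lemma cmod_add_power2_le: "(cmod (a + b))\<^sup>2 \<le> 2 * (cmod a)\<^sup>2 + 2 * (cmod b)\<^sup>2"
proof -
  have "(cmod (a + b))\<^sup>2 \<le> (cmod a + cmod b)\<^sup>2"
    by (intro power_mono norm_triangle_ineq) auto
  also have "\<dots> \<le> 2 * (cmod a)\<^sup>2 + 2 * (cmod b)\<^sup>2"
    using sum_squares_bound[of "cmod a" "cmod b"] by (simp add: power2_sum)
  finally show ?thesis .
qed

lemma ell2_add:
  assumes "f \<in> ell2 X" "g \<in> ell2 X"
  shows "(\<lambda>x. f x + g x) \<in> ell2 X"
proof (rule ell2I)
  have "(\<lambda>x. 2 * (cmod (f x))\<^sup>2 + 2 * (cmod (g x))\<^sup>2) summable_on X"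
    using assms by (intro summable_on_add summable_on_cmult_right ell2_summable)
  then show "(\<lambda>x. (cmod (f x + g x))\<^sup>2) summable_on X"
    by (rule summable_on_comparison_test) (auto intro: cmod_add_power2_le)
qed (use assms in \<open>auto simp: ell2_def\<close>)

lemma ell2_scale:
  assumes "f \<in> ell2 X"
  shows "(\<lambda>x. c * f x) \<in> ell2 X"
proof (rule ell2I)
  have "(\<lambda>x. (cmod c)\<^sup>2 * (cmod (f x))\<^sup>2) summable_on X"
    using assms by (intro summable_on_cmult_right ell2_summable)
  then show "(\<lambda>x. (cmod (c * f x))\<^sup>2) summable_on X"
    by (simp add: norm_mult power_mult_distrib)
qed (use assms in \<open>auto simp: ell2_def\<close>)

lemma ell2_zero: "(\<lambda>x. 0) \<in> ell2 X"
  by (auto simp: ell2_def)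

lemma ell2_sum:
  "\<lbrakk>finite I; \<And>i. i \<in> I \<Longrightarrow> f i \<in> ell2 X\<rbrakk> \<Longrightarrow> (\<lambda>x. \<Sum>i\<in>I. f i x) \<in> ell2 X"
  by (induction I rule: finite_induct) (auto intro: ell2_zero ell2_add)

lemma ell2_diff:
  assumes "f \<in> ell2 X" "g \<in> ell2 X"
  shows "(\<lambda>x. f x - g x) \<in> ell2 X"
  using ell2_add[OF assms(1) ell2_scale[OF assms(2), of "-1"]] by simp

lemma ell2_single: "x \<in> X \<Longrightarrow> (\<lambda>y. if y = x then 1 else 0) \<in> ell2 X"
proof (rule ell2I)
  assume "x \<in> X"
  have "(\<lambda>y. (cmod (if y = x then 1 else 0))\<^sup>2) summable_on {x}" by simp
  then show "(\<lambda>y. (cmod (if y = x then 1 else 0))\<^sup>2) summable_on X"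
    by (rule summable_on_cong_neutral[THEN iffD1, rotated -1]) (use \<open>x \<in> X\<close> in auto)
qed auto

text \<open>Grouping a finite sum over \<open>A\<close> by the values of \<open>h\<close> costs at
  most a factor \<open>N\<close>. It is applied to \<open>butlast\<close>, whose fibres are
  controlled by bounded degree, and to \<open>orient\<close>, whose fibres have at most
  \<open>fact (Suc p)\<close> elements.\<close>

lemma summable_on_finite_fibers:
  fixes g :: "'b \<Rightarrow> real"
  assumes "g summable_on B" "\<And>y. y \<in> B \<Longrightarrow> 0 \<le> g y" "h ` A \<subseteq> B"
    and fib: "\<And>y. y \<in> B \<Longrightarrow> finite {x \<in> A. h x = y} \<and> card {x \<in> A. h x = y} \<le> N"
  shows "(\<lambda>x. g (h x)) summable_on A"
proof (rule nonneg_bdd_above_summable_on)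
  show "bdd_above (sum (\<lambda>x. g (h x)) ` {F. F \<subseteq> A \<and> finite F})"
  proof (rule bdd_aboveI2)
    fix F assume "F \<in> {F. F \<subseteq> A \<and> finite F}"
    then have F: "F \<subseteq> A" "finite F" by auto
    have "(\<Sum>x\<in>F. g (h x)) = (\<Sum>y\<in>h ` F. \<Sum>x\<in>{x \<in> F. h x = y}. g (h x))"
      using F by (intro sum.group[symmetric]) auto
    also have "\<dots> \<le> (\<Sum>y\<in>h ` F. real N * g y)"
    proof (rule sum_mono)
      fix y assume y: "y \<in> h ` F"
      then have yB: "y \<in> B" using F assms(3) by auto
      have "card {x \<in> F. h x = y} \<le> card {x \<in> A. h x = y}"
        using fib[OF yB] F by (intro card_mono) auto
      then have "card {x \<in> F. h x = y} \<le> N" using fib[OF yB] by linarith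
      then show "(\<Sum>x\<in>{x \<in> F. h x = y}. g (h x)) \<le> real N * g y"
        using assms(2)[OF yB] by (auto intro: mult_right_mono)
    qed
    also have "\<dots> = real N * (\<Sum>y\<in>h ` F. g y)" by (simp add: sum_distrib_left)
    also have "\<dots> \<le> real N * infsum g B"
      using F assms by (intro mult_left_mono finite_sum_le_infsum) auto
    finally show "(\<Sum>x\<in>F. g (h x)) \<le> real N * infsum g B" .
  qed
qed (use assms in auto)

section \<open>Inner products, adjoints and sums over fibres\<close>

lemma ell2_inner_single:
  assumes "x \<in> X"
  shows "ell2_inner X (\<lambda>y. if y = x then 1 else 0) h = cnj (h x)"
proof -
  have "ell2_inner X (\<lambda>y. if y = x then 1 else 0) h =
    (\<Sum>\<^sub>\<infinity>y\<in>{x}. (if y = x then 1 else 0) * cnj (h y))"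
    unfolding ell2_inner_def by (rule infsum_cong_neutral) (use assms in auto)
  then show ?thesis by simp
qed

text \<open>Point masses belong to \<open>ell2 X\<close>, and pairing with them recovers every value
  on \<open>X\<close>; off \<open>X\<close> all candidates vanish. Hence a function with the adjoint
  property is the one that \<open>THE\<close> selects.\<close>

lemma ell2_adjoint_eq:
  assumes "h \<in> ell2 X" "\<And>f. f \<in> ell2 X \<Longrightarrow> ell2_inner Y (T f) g = ell2_inner X f h"
  shows "ell2_adjoint X Y T g = h"
  unfolding ell2_adjoint_def
proof (rule the_equality)
  fix h' assume h': "h' \<in> ell2 X \<and> (\<forall>f\<in>ell2 X. ell2_inner Y (T f) g = ell2_inner X f h')"
  show "h' = h"
  proof
    fix x
    show "h' x = h x"
    proof (cases "x \<in> X")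
      case True
      then show ?thesis
        using h' assms(2)[OF ell2_single[OF True]] ell2_single[OF True]
          ell2_inner_single[OF True, of h] ell2_inner_single[OF True, of h'] by auto
    next
      case False
      then show ?thesis using h' assms(1) ell2D[of h' X x] ell2D[of h X x] by simp
    qed
  qed
qed (use assms in auto)

lemma ell2_mult_summable:
  assumes "f \<in> ell2 X" "g \<in> ell2 X"
  shows "(\<lambda>x. norm (f x * cnj (g x))) summable_on X"
proof -
  have "(\<lambda>x. (cmod (f x))\<^sup>2 + (cmod (g x))\<^sup>2) summable_on X"
    using assms by (intro summable_on_add ell2_summable)
  then show ?thesis
  proof (rule summable_on_comparison_test)
    fix x
    have "2 * (cmod (f x) * cmod (g x)) \<le> (cmod (f x))\<^sup>2 + (cmod (g x))\<^sup>2"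
      using sum_squares_bound[of "cmod (f x)" "cmod (g x)"] by simp
    moreover have "0 \<le> cmod (f x) * cmod (g x)" by simp
    ultimately show "norm (f x * cnj (g x)) \<le> (cmod (f x))\<^sup>2 + (cmod (g x))\<^sup>2"
      unfolding norm_mult complex_mod_cnj by linarith
  qed auto
qed

text \<open>\<open>Y\<close> is the disjoint union of the fibres, realised as a \<open>Sigma\<close>
  set through \<open>y \<mapsto> (h y, y)\<close>. Absolute summability permits the
  regrouping.\<close>

lemma infsum_fibers:
  fixes F :: "'b \<Rightarrow> complex"
  assumes "(\<lambda>y. norm (F y)) summable_on Y" "h ` Y \<subseteq> X"
    and "\<And>x. x \<in> X \<Longrightarrow> finite {y \<in> Y. h y = x}"
  shows "infsum F Y = (\<Sum>\<^sub>\<infinity>x\<in>X. \<Sum>y\<in>{y \<in> Y. h y = x}. F y)"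
proof -
  let ?B = "\<lambda>x. {y \<in> Y. h y = x}"
  have bij: "bij_betw snd (Sigma X ?B) Y"
    by (rule bij_betwI[where g = "\<lambda>y. (h y, y)"]) (use assms(2) in auto)
  have "F summable_on Y" using assms(1) by (rule abs_summable_summable)
  then have "(\<lambda>z. F (snd z)) summable_on Sigma X ?B"
    using summable_on_reindex_bij_betw[OF bij, of F] by simp
  then have "(\<Sum>\<^sub>\<infinity>x\<in>X. \<Sum>\<^sub>\<infinity>y\<in>?B x. F y) = (\<Sum>\<^sub>\<infinity>z\<in>Sigma X ?B. F (snd z))"
    using infsum_Sigma_banach[of "\<lambda>z. F (snd z)" X ?B] by simp
  also have "\<dots> = infsum F Y" by (rule infsum_reindex_bij_betw[OF bij])
  finally show ?thesis
    using assms(3) by (auto cong: infsum_cong)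
qed

text \<open>Cauchy-Schwarz on each finite fibre costs a factor equal to the size of the fibre, which
  the hypothesis on \<open>c\<close> absorbs. For the adjoint of \<open>walk_alpha\<close> the
  coefficient is one over the square root of that size.\<close>

lemma ell2_fiber_sum:
  fixes g :: "'b \<Rightarrow> complex"
  assumes "g \<in> ell2 Y" and fib: "\<And>x. x \<in> X \<Longrightarrow> finite {y \<in> Y. h y = x}"
    and c: "\<And>x. x \<in> X \<Longrightarrow> (cmod (c x))\<^sup>2 * card {y \<in> Y. h y = x} \<le> 1"
  shows "(\<lambda>x. if x \<in> X then c x * (\<Sum>y\<in>{y \<in> Y. h y = x}. g y) else 0) \<in> ell2 X"
proof (rule ell2I)
  let ?B = "\<lambda>x. {y \<in> Y. h y = x}"
  have "(\<lambda>x. \<Sum>y\<in>?B x. (cmod (g y))\<^sup>2) summable_on X"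
  proof (rule nonneg_bdd_above_summable_on)
    show "bdd_above (sum (\<lambda>x. \<Sum>y\<in>?B x. (cmod (g y))\<^sup>2) ` {F. F \<subseteq> X \<and> finite F})"
    proof (rule bdd_aboveI2)
      fix F assume "F \<in> {F. F \<subseteq> X \<and> finite F}"
      then have F: "F \<subseteq> X" "finite F" by auto
      have "(\<Sum>x\<in>F. \<Sum>y\<in>?B x. (cmod (g y))\<^sup>2) = (\<Sum>y\<in>(\<Union>x\<in>F. ?B x). (cmod (g y))\<^sup>2)"
        using F fib by (intro sum.UNION_disjoint[symmetric]) auto
      also have "\<dots> \<le> (\<Sum>\<^sub>\<infinity>y\<in>Y. (cmod (g y))\<^sup>2)"
        using F fib ell2_summable[OF assms(1)] by (intro finite_sum_le_infsum) auto
      finally show "(\<Sum>x\<in>F. \<Sum>y\<in>?B x. (cmod (g y))\<^sup>2) \<le> (\<Sum>\<^sub>\<infinity>y\<in>Y. (cmod (g y))\<^sup>2)" .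
    qed
  qed (auto intro: sum_nonneg)
  then show "(\<lambda>x. (cmod (if x \<in> X then c x * sum g (?B x) else 0))\<^sup>2) summable_on X"
  proof (rule summable_on_comparison_test)
    fix x assume x: "x \<in> X"
    have "(cmod (sum g (?B x)))\<^sup>2 \<le> (\<Sum>y\<in>?B x. cmod (g y))\<^sup>2"
      by (intro power_mono norm_sum) auto
    also have "\<dots> \<le> card (?B x) * (\<Sum>y\<in>?B x. (cmod (g y))\<^sup>2)"
      using sum_squared_le_sum_of_squares[of "\<lambda>y. cmod (g y)" "?B x"] fib[OF x]
      by (simp add: mult.commute)
    finally have "(cmod (c x))\<^sup>2 * (cmod (sum g (?B x)))\<^sup>2 \<le>
      ((cmod (c x))\<^sup>2 * card (?B x)) * (\<Sum>y\<in>?B x. (cmod (g y))\<^sup>2)"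
      by (simp add: mult_left_mono mult.assoc)
    also have "\<dots> \<le> 1 * (\<Sum>y\<in>?B x. (cmod (g y))\<^sup>2)"
      using c[OF x] by (intro mult_right_mono sum_nonneg) auto
    finally show "(cmod (if x \<in> X then c x * sum g (?B x) else 0))\<^sup>2 \<le> (\<Sum>y\<in>?B x. (cmod (g y))\<^sup>2)"
      using x by (simp add: norm_mult power_mult_distrib)
  qed auto
qed auto

lemma of_real_sqrt_mult_self: "0 \<le> x \<Longrightarrow> complex_of_real (sqrt x) * complex_of_real (sqrt x) = of_real x"
  by (metis of_real_mult real_sqrt_mult_self abs_of_nonneg)

lemma complex_subspaceI:
  assumes "(\<lambda>x. 0) \<in> W" "\<And>f g. f \<in> W \<Longrightarrow> g \<in> W \<Longrightarrow> (\<lambda>x. f x + g x) \<in> W"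
    "\<And>c f. f \<in> W \<Longrightarrow> (\<lambda>x. c * f x) \<in> W"
  shows "complex_subspace W"
proof -
  interpret module "\<lambda>(c::complex) f x. c * f x"
    by unfold_locales (auto simp: algebra_simps)
  show ?thesis
    unfolding complex_subspace_def using assms
    by (auto simp: subspace_def zero_fun_def plus_fun_def)
qed

text \<open>The final arithmetic with \<open>n = q\<close> and \<open>m = q + 1\<close>:
  \<open>a\<close> is the value of the function at an ordered simplex, \<open>x\<close> is the
  exchange sum there, and \<open>x / n\<close> is minus the value of the up discriminant.\<close>

lemma discriminant_identity:
  fixes a x :: complex and m n :: real
  assumes "0 < n" "m = n + 1"
  shows "a - (2 * ((a - x) / of_real m) - a) = of_real (2 * n / m) * (a + x / of_real n)"
proof -
  define N where "N = complex_of_real n"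
  have m: "complex_of_real m = N + 1" by (simp add: assms(2) N_def)
  have "complex_of_real (n + 1) \<noteq> 0"
    unfolding of_real_eq_0_iff using assms(1) by linarith
  then have N: "N \<noteq> 0" "N + 1 \<noteq> 0" using assms(1) by (simp_all add: N_def)
  have "2 * N / (N + 1) * (a + x / N) = 2 * (N * (a + x / N)) / (N + 1)" by simp
  also have "N * (a + x / N) = N * a + x" using N(1) by (simp add: distrib_left)
  also have "2 * (N * a + x) / (N + 1) = a - (2 * ((a - x) / (N + 1)) - a)"
    using N(2) by (simp add: field_simps)
  finally show ?thesis by (simp only: m N_def[symmetric] of_real_divide of_real_mult of_real_numeral)
qed

section \<open>The discriminant of the walk\<close>

text \<open>\<open>extendable\<close> is the form in which purity and the bound on the dimension
  enter: every \<open>p\<close>-simplex has a coface, so the degrees under the square roots in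
  denominators are positive.\<close>

locale extendable_complex =
  fixes S :: "'a set set" and p :: nat
  assumes subset_closed: "\<And>F G. F \<in> S \<Longrightarrow> G \<subseteq> F \<Longrightarrow> G \<in> S"
    and bounded: "bounded_degree S"
    and extendable: "\<And>F. F \<in> S \<Longrightarrow> card F = Suc p \<Longrightarrow> \<exists>v. v \<notin> F \<and> insert v F \<in> S"
begin

abbreviation X :: "'a list set" where "X \<equiv> ordered_simplices S p"
abbreviation Y :: "'a list set" where "Y \<equiv> ordered_simplices S (Suc p)"
abbreviation dg :: "'a list \<Rightarrow> nat" where "dg \<equiv> ordered_degree S p"

text \<open>These are the vertices of the link of the simplex \<open>set t\<close>. They index the
  fibre of \<open>butlast\<close> over \<open>t\<close> and also the
  \<open>(p + 1)\<close>-simplices containing \<open>set t\<close>, which is why the degrees of the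
  walk and of the up discriminant agree.\<close>

definition link :: "'a list \<Rightarrow> 'a set" where
  "link t = {v. v \<notin> set t \<and> insert v (set t) \<in> S}"

section \<open>One-vertex extensions of ordered simplices\<close>

lemma snoc_in_Y_iff: "t @ [v] \<in> Y \<longleftrightarrow> t \<in> X \<and> v \<in> link t"
  using subset_closed[of "insert v (set t)" "set t"]
  by (auto simp: ordered_simplices_iff link_def)

lemma Y_cases:
  assumes "s \<in> Y"
  obtains t v where "s = t @ [v]" "t \<in> X" "v \<in> link t"
proof -
  have "s \<noteq> []" using assms by (auto simp: ordered_simplices_iff)
  then have s: "s = butlast s @ [last s]" by simp
  then have "butlast s @ [last s] \<in> Y" using assms by simp
  then show thesis using that[OF s] snoc_in_Y_iff by blast
qed

lemma butlast_Y: "butlast ` Y \<subseteq> X"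
  by (auto elim: Y_cases)

lemma fiber_eq: "t \<in> X \<Longrightarrow> {s \<in> Y. butlast s = t} = (\<lambda>v. t @ [v]) ` link t"
  by (auto simp: snoc_in_Y_iff elim: Y_cases)

lemma sum_fiber: "t \<in> X \<Longrightarrow> (\<Sum>s\<in>{s \<in> Y. butlast s = t}. g s) = (\<Sum>v\<in>link t. g (t @ [v]))"
  by (simp add: fiber_eq sum.reindex inj_on_def)

lemma degree_eq: "t \<in> X \<Longrightarrow> dg t = card (link t)"
  by (simp add: ordered_degree_def fiber_eq card_image inj_on_def)

text \<open>The map \<open>v \<mapsto> insert v (set t)\<close> injects the link into the simplices
  containing \<open>set t\<close>, so bounded degree gives one bound for all
  \<open>t\<close>.\<close>

lemma degree_bounded: "\<exists>N. \<forall>t\<in>X. finite (link t) \<and> card (link t) \<le> N"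
proof -
  obtain c where c: "\<And>F. F \<in> S \<Longrightarrow> F \<noteq> {} \<Longrightarrow> finite {G \<in> S. F \<subseteq> G} \<and> card {G \<in> S. F \<subseteq> G} \<le> c"
    using bounded unfolding bounded_degree_def by blast
  have "finite (link t) \<and> card (link t) \<le> c" if t: "t \<in> X" for t
  proof -
    have inj: "inj_on (\<lambda>v. insert v (set t)) (link t)"
      by (auto simp: inj_on_def link_def)
    have sub: "(\<lambda>v. insert v (set t)) ` link t \<subseteq> {G \<in> S. set t \<subseteq> G}"
      by (auto simp: link_def)
    have "finite {G \<in> S. set t \<subseteq> G}" "card {G \<in> S. set t \<subseteq> G} \<le> c"
      using c[of "set t"] t by (fastforce simp: ordered_simplices_iff)+
    then show ?thesis
      using inj_on_finite[OF inj sub] card_inj_on_le[OF inj sub] le_trans by blast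
  qed
  then show ?thesis by blast
qed

lemma finite_link: "t \<in> X \<Longrightarrow> finite (link t)"
  using degree_bounded by blast

lemma finite_fiber: "t \<in> X \<Longrightarrow> finite {s \<in> Y. butlast s = t}"
  by (simp add: fiber_eq finite_link)

lemma degree_pos: "t \<in> X \<Longrightarrow> dg t > 0"
  using extendable[of "set t"] finite_link[of t] distinct_card[of t]
  by (auto simp: degree_eq card_gt_0_iff ordered_simplices_iff link_def)

lemma permute_in_X: "t \<in> X \<Longrightarrow> \<pi> permutes {..<Suc p} \<Longrightarrow> permute_list \<pi> t \<in> X"
  by (auto simp: ordered_simplices_iff)

lemma permute_in_Y: "s \<in> Y \<Longrightarrow> \<pi> permutes {..<Suc (Suc p)} \<Longrightarrow> permute_list \<pi> s \<in> Y"
  by (auto simp: ordered_simplices_iff)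

lemma link_cong: "set t = set t' \<Longrightarrow> link t = link t'"
  by (simp add: link_def)

lemma degree_permute:
  assumes "t \<in> X" "\<pi> permutes {..<Suc p}"
  shows "dg (permute_list \<pi> t) = dg t"
proof -
  have "set (permute_list \<pi> t) = set t"
    using assms by (intro set_permute_list) (simp add: ordered_simplices_iff)
  then have "link (permute_list \<pi> t) = link t" by (rule link_cong)
  then show ?thesis
    using assms by (simp add: degree_eq permute_in_X)
qed

lemma exchange_in_Y:
  assumes "t \<in> X" "v \<in> link t" "j < Suc p"
  shows "t[j := v] @ [t ! j] \<in> Y"
proof -
  have "permute_list (Transposition.transpose (length t) j) (t @ [v]) \<in> Y"
  proof (rule permute_in_Y)
    show "t @ [v] \<in> Y" using assms by (simp add: snoc_in_Y_iff)
    show "Transposition.transpose (length t) j permutes {..<Suc (Suc p)}"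
      using assms by (intro permutes_swap_id) (auto simp: ordered_simplices_iff)
  qed
  moreover have "j < length t" using assms by (simp add: ordered_simplices_iff)
  ultimately show ?thesis by (simp only: permute_list_transpose_last)
qed

section \<open>The isometry \<open>walk_alpha\<close> and its adjoint\<close>

lemma walk_alpha_snoc:
  "t \<in> X \<Longrightarrow> v \<in> link t \<Longrightarrow> walk_alpha S p f (t @ [v]) = f t / sqrt (dg t)"
  by (simp add: walk_alpha_def snoc_in_Y_iff)

lemma walk_alpha_ell2:
  assumes "f \<in> ell2 X"
  shows "walk_alpha S p f \<in> ell2 Y"
proof (rule ell2I)
  obtain N where N: "\<And>t. t \<in> X \<Longrightarrow> card (link t) \<le> N"
    using degree_bounded by blast
  have "(\<lambda>s. (cmod (f (butlast s)))\<^sup>2) summable_on Y"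
    by (rule summable_on_finite_fibers[where N = N, OF ell2_summable[OF assms] _ butlast_Y])
      (auto simp: finite_link N fiber_eq card_image inj_on_def)
  then show "(\<lambda>s. (cmod (walk_alpha S p f s))\<^sup>2) summable_on Y"
  proof (rule summable_on_comparison_test)
    fix s assume "s \<in> Y"
    then obtain t v where s: "s = t @ [v]" "t \<in> X" "v \<in> link t" by (rule Y_cases)
    \<comment> \<open>Only square summability is at stake, so the weight \<open>1 / dg t\<close> may
      be estimated by 1.\<close>
    have "1 \<le> real (dg t)" using degree_pos[OF s(2)] by linarith
    then show "(cmod (walk_alpha S p f s))\<^sup>2 \<le> (cmod (f (butlast s)))\<^sup>2"
      using s by (simp add: walk_alpha_snoc norm_divide power_divide divide_le_eq
          mult_le_cancel_left1)
  qed auto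
qed (simp add: walk_alpha_def)

text \<open>Each permutation of positions acts injectively on \<open>Y\<close>, so permuting the
  entries preserves square summability; the antisymmetrizer is a finite combination of such
  terms.\<close>

lemma antisymmetrizer_ell2:
  assumes "g \<in> ell2 Y"
  shows "antisymmetrizer S (Suc p) g \<in> ell2 Y"
proof -
  have perm: "(\<lambda>s. if s \<in> Y then g (permute_list \<pi> s) else 0) \<in> ell2 Y"
    if \<pi>: "\<pi> permutes {..<Suc (Suc p)}" for \<pi>
  proof (rule ell2I)
    have inj: "inj_on (permute_list \<pi>) Y"
    proof (rule inj_on_inverseI)
      fix s assume "s \<in> Y"
      then have "length s = Suc (Suc p)" by (simp add: ordered_simplices_iff)
      then show "permute_list (inv \<pi>) (permute_list \<pi> s) = s"
        using \<pi> permute_list_compose[of "inv \<pi>" s \<pi>] permutes_inv[OF \<pi>]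
        by (simp add: permutes_inv_o)
    qed
    have "permute_list \<pi> ` Y \<subseteq> Y" using permute_in_Y[OF _ \<pi>] by auto
    then have "(\<lambda>s. (cmod (g s))\<^sup>2) summable_on permute_list \<pi> ` Y"
      by (rule summable_on_subset[OF ell2_summable[OF assms]])
    then show "(\<lambda>s. (cmod (if s \<in> Y then g (permute_list \<pi> s) else 0))\<^sup>2) summable_on Y"
      by (simp add: summable_on_reindex[OF inj] o_def cong: summable_on_cong)
  qed simp
  have "(\<lambda>s. 1 / fact (Suc p + 1) * (\<Sum>\<pi> | \<pi> permutes {..<Suc p + 1}. of_int (sign \<pi>) *
    (if s \<in> Y then g (permute_list \<pi> s) else 0))) \<in> ell2 Y"
    by (intro ell2_scale ell2_sum finite_permutations) (auto intro: perm)
  moreover have "antisymmetrizer S (Suc p) g =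
    (\<lambda>s. 1 / fact (Suc p + 1) * (\<Sum>\<pi> | \<pi> permutes {..<Suc p + 1}. of_int (sign \<pi>) *
    (if s \<in> Y then g (permute_list \<pi> s) else 0)))"
    by (auto simp: antisymmetrizer_def fun_eq_iff)
  ultimately show ?thesis by simp
qed

text \<open>Grouping the inner product over \<open>Y\<close> by the fibres of \<open>butlast\<close>
  exhibits the adjoint as a weighted fibre sum. Its membership in \<open>ell2 X\<close> is part of
  what identifies it with the function chosen by \<open>THE\<close>.\<close>

lemma walk_alpha_adj_eq:
  assumes "g \<in> ell2 Y"
  shows "walk_alpha_adj S p g =
    (\<lambda>t. if t \<in> X then (\<Sum>v\<in>link t. g (t @ [v])) / sqrt (dg t) else 0)" (is "_ = ?h")
    and "walk_alpha_adj S p g \<in> ell2 X"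
proof -
  have h: "?h = (\<lambda>t. if t \<in> X then complex_of_real (1 / sqrt (dg t)) *
      (\<Sum>s\<in>{s \<in> Y. butlast s = t}. g s) else 0)"
    by (auto simp: fun_eq_iff sum_fiber)
  have h_ell2: "?h \<in> ell2 X"
    unfolding h
  proof (rule ell2_fiber_sum[OF assms finite_fiber])
    fix t assume "t \<in> X"
    then show "(cmod (complex_of_real (1 / sqrt (dg t))))\<^sup>2 * card {s \<in> Y. butlast s = t} \<le> 1"
      using degree_pos[of t] by (simp add: norm_divide power_divide ordered_degree_def)
  qed
  have "walk_alpha_adj S p g = ?h"
    unfolding walk_alpha_adj_def
  proof (rule ell2_adjoint_eq[OF h_ell2])
    fix f assume f: "f \<in> ell2 X"
    have "ell2_inner Y (walk_alpha S p f) g =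
      (\<Sum>\<^sub>\<infinity>t\<in>X. \<Sum>s\<in>{s \<in> Y. butlast s = t}. walk_alpha S p f s * cnj (g s))"
      unfolding ell2_inner_def
      by (rule infsum_fibers[OF ell2_mult_summable[OF walk_alpha_ell2[OF f] assms] butlast_Y
            finite_fiber])
    also have "\<dots> = ell2_inner X f ?h"
      unfolding ell2_inner_def
      by (rule infsum_cong)
        (simp add: sum_fiber walk_alpha_snoc sum_distrib_left sum_divide_distrib)
    finally show "ell2_inner Y (walk_alpha S p f) g = ell2_inner X f ?h" .
  qed
  then show "walk_alpha_adj S p g = ?h" "walk_alpha_adj S p g \<in> ell2 X"
    using h_ell2 by simp_all
qed

text \<open>Each of the \<open>dg t\<close> extensions of \<open>t\<close> contributes
  \<open>f t / dg t\<close>.\<close>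

lemma walk_alpha_adj_alpha:
  assumes "f \<in> ell2 X"
  shows "walk_alpha_adj S p (walk_alpha S p f) = f"
proof
  fix t
  show "walk_alpha_adj S p (walk_alpha S p f) t = f t"
  proof (cases "t \<in> X")
    case True
    then show ?thesis
      using degree_pos[OF True] degree_eq[OF True]
      by (simp add: walk_alpha_adj_eq(1)[OF walk_alpha_ell2[OF assms]] walk_alpha_snoc
          of_real_sqrt_mult_self flip: of_real_mult)
  next
    case False
    then show ?thesis
      using ell2D[OF assms] by (simp add: walk_alpha_adj_eq(1)[OF walk_alpha_ell2[OF assms]])
  qed
qed

lemma walk_discriminant_eq:
  assumes "f \<in> ell2 X"
  shows "walk_discriminant S (Suc p) f = (\<lambda>t. if t \<in> X
    then 2 * (\<Sum>v\<in>link t. antisymmetrizer S (Suc p) (walk_alpha S p f) (t @ [v])) / sqrt (dg t) - f t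
    else 0)"
    and "walk_discriminant S (Suc p) f \<in> ell2 X"
proof -
  let ?a = "walk_alpha S p f"
  let ?P = "antisymmetrizer S (Suc p) ?a"
  have a: "?a \<in> ell2 Y" using assms by (rule walk_alpha_ell2)
  then have G_ell2: "(\<lambda>s. 2 * ?P s - ?a s) \<in> ell2 Y"
    by (intro ell2_diff ell2_scale antisymmetrizer_ell2)
  \<comment> \<open>The coin reflects in the range of \<alpha> and so fixes it pointwise: twice
    \<open>?a\<close> minus \<open>?a\<close>.\<close>
  have "walk_coin S (Suc p) ?a = ?a"
    by (simp add: walk_coin_def walk_alpha_adj_alpha[OF assms])
  then have D: "walk_discriminant S (Suc p) f = walk_alpha_adj S p (\<lambda>s. 2 * ?P s - ?a s)"
    by (simp add: walk_discriminant_def modified_walk_def walk_shift_def)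
  show "walk_discriminant S (Suc p) f \<in> ell2 X"
    unfolding D by (rule walk_alpha_adj_eq(2)[OF G_ell2])
  have split: "walk_alpha_adj S p (\<lambda>s. 2 * ?P s - ?a s) t =
      2 * (\<Sum>v\<in>link t. ?P (t @ [v])) / sqrt (dg t) - walk_alpha_adj S p ?a t" if "t \<in> X" for t
    using that
    by (simp add: walk_alpha_adj_eq(1)[OF G_ell2] walk_alpha_adj_eq(1)[OF a] sum_subtractf
        sum_distrib_left diff_divide_distrib)
  show "walk_discriminant S (Suc p) f = (\<lambda>t. if t \<in> X
    then 2 * (\<Sum>v\<in>link t. ?P (t @ [v])) / sqrt (dg t) - f t else 0)"
    using split walk_alpha_adj_alpha[OF assms]
    by (auto simp: D fun_eq_iff walk_alpha_adj_eq(1)[OF G_ell2])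
qed

section \<open>The antisymmetrizer on the range of \<open>walk_alpha\<close>\<close>

lemma antisymmetrizer_alpha_symmetric:
  assumes "1 \<le> p" and sym: "\<And>t \<pi>. t \<in> X \<Longrightarrow> \<pi> permutes {..<Suc p} \<Longrightarrow> f (permute_list \<pi> t) = f t"
  shows "antisymmetrizer S (Suc p) (walk_alpha S p f) s = 0"
proof (cases "s \<in> Y")
  case True
  let ?a = "walk_alpha S p f"
  let ?\<tau> = "Transposition.transpose (0::nat) 1"
  let ?Q = "{\<pi>. \<pi> permutes {..<Suc (Suc p)}}"
  \<comment> \<open>Both swapped positions 0 and 1 lie among those kept by \<open>butlast\<close>;
    this is where \<open>1 \<le> p\<close> enters.\<close>
  have \<tau>: "?\<tau> permutes {..<Suc p}" "?\<tau> permutes {..<Suc (Suc p)}"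
    using assms(1) by (auto intro!: permutes_swap_id)
  have inv: "?a (permute_list ?\<tau> r) = ?a r" if r: "r \<in> Y" for r
  proof -
    obtain t v where t: "r = t @ [v]" "t \<in> X" "v \<in> link t" using r by (rule Y_cases)
    have len: "length t = Suc p" using t by (simp add: ordered_simplices_iff)
    have "permute_list ?\<tau> t \<in> X" using permute_in_X[OF t(2) \<tau>(1)] .
    moreover have "set (permute_list ?\<tau> t) = set t"
      using \<tau>(1) len by (intro set_permute_list) simp
    then have "v \<in> link (permute_list ?\<tau> t)" using link_cong t(3) by blast
    ultimately show ?thesis
      using t permute_list_snoc[of ?\<tau> t v] \<tau>(1) len
      by (simp add: walk_alpha_snoc sym degree_permute)
  qed
  \<comment> \<open>Composing with the transposition permutes the summands and reverses every sign,
    so the sum equals its own negative.\<close>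
  have "(\<Sum>\<pi>\<in>?Q. of_int (sign \<pi>) * ?a (permute_list \<pi> s)) =
    (\<Sum>\<pi>\<in>?Q. of_int (sign (\<pi> \<circ> ?\<tau>)) * ?a (permute_list (\<pi> \<circ> ?\<tau>) s))"
    by (rule sum_permutations_compose_right[OF \<tau>(2)])
  also have "\<dots> = (\<Sum>\<pi>\<in>?Q. - (of_int (sign \<pi>) * ?a (permute_list \<pi> s)))"
  proof (rule sum.cong)
    fix \<pi> assume "\<pi> \<in> ?Q"
    then have \<pi>: "\<pi> permutes {..<Suc (Suc p)}" by simp
    have "permutation \<pi>" using \<pi> permutation_permutes by blast
    then have "sign (\<pi> \<circ> ?\<tau>) = - sign \<pi>"
      by (simp add: sign_compose permutation_swap_id sign_swap_id)
    moreover have "permute_list (\<pi> \<circ> ?\<tau>) s = permute_list ?\<tau> (permute_list \<pi> s)"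
      using True \<tau>(2) by (intro permute_list_compose) (simp add: ordered_simplices_iff)
    ultimately show "of_int (sign (\<pi> \<circ> ?\<tau>)) * ?a (permute_list (\<pi> \<circ> ?\<tau>) s) =
        - (of_int (sign \<pi>) * ?a (permute_list \<pi> s))"
      using inv[OF permute_in_Y[OF True \<pi>]] by simp
  qed simp
  finally have "(\<Sum>\<pi>\<in>?Q. of_int (sign \<pi>) * ?a (permute_list \<pi> s)) = 0"
    by (simp add: sum_negf)
  then show ?thesis by (simp add: antisymmetrizer_def)
qed (simp add: antisymmetrizer_def)

lemma antisymmetrizer_alpha_antisymmetric:
  assumes anti: "\<And>t \<pi>. t \<in> X \<Longrightarrow> \<pi> permutes {..<Suc p} \<Longrightarrow>
      f (permute_list \<pi> t) = of_int (sign \<pi>) * f t"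
    and t: "t \<in> X" "v \<in> link t"
  shows "antisymmetrizer S (Suc p) (walk_alpha S p f) (t @ [v]) =
    (f t / sqrt (dg t) - (\<Sum>j<Suc p. f (t[j := v]) / sqrt (dg (t[j := v])))) / (real p + 2)"
proof -
  let ?a = "walk_alpha S p f"
  let ?Q = "{\<rho>. \<rho> permutes {..<Suc p}}"
  let ?T = "\<lambda>b. Transposition.transpose (Suc p) b"
  have len: "length t = Suc p" using t by (simp add: ordered_simplices_iff)
  \<comment> \<open>For fixed \<open>b\<close> all \<open>fact (Suc p)\<close> terms agree: the sign
    of \<open>\<rho>\<close> from the antisymmetrizer meets the same sign produced by the
    antisymmetry of \<open>f\<close>, and their product is 1.\<close>
  have inner: "(\<Sum>\<rho>\<in>?Q. of_int (sign (?T b \<circ> \<rho>)) * ?a (permute_list (?T b \<circ> \<rho>) (t @ [v]))) =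
      fact (Suc p) * (of_int (sign (?T b)) * (f u / sqrt (dg u)))"
    if uw: "permute_list (?T b) (t @ [v]) = u @ [w]" "u @ [w] \<in> Y" for b u w
  proof -
    have u: "u \<in> X" "w \<in> link u" using uw(2) snoc_in_Y_iff by auto
    have lenu: "length u = Suc p" using u by (simp add: ordered_simplices_iff)
    have "of_int (sign (?T b \<circ> \<rho>)) * ?a (permute_list (?T b \<circ> \<rho>) (t @ [v])) =
      of_int (sign (?T b)) * (f u / sqrt (dg u))" if "\<rho> \<in> ?Q" for \<rho>
    proof -
      have \<rho>: "\<rho> permutes {..<Suc p}" using that by simp
      then have "\<rho> permutes {..<length (t @ [v])}"
        by (rule permutes_subset) (use len in auto)
      then have "permute_list (?T b \<circ> \<rho>) (t @ [v]) = permute_list \<rho> (u @ [w])"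
        using permute_list_compose[of \<rho> "t @ [v]" "?T b"] uw(1) by simp
      also have "\<dots> = permute_list \<rho> u @ [w]"
        using permute_list_snoc[of \<rho> u w] \<rho> lenu by simp
      also have "?a \<dots> = of_int (sign \<rho>) * (f u / sqrt (dg u))"
      proof -
        have "set (permute_list \<rho> u) = set u"
          using \<rho> lenu by (intro set_permute_list) simp
        then have "w \<in> link (permute_list \<rho> u)" using link_cong u(2) by blast
        then show ?thesis
          using u \<rho> by (simp add: walk_alpha_snoc permute_in_X anti degree_permute)
      qed
      moreover have "sign (?T b \<circ> \<rho>) = sign (?T b) * sign \<rho>"
        using \<rho> permutation_permutes[of \<rho>] by (intro sign_compose permutation_swap_id) blast
      ultimately show ?thesis by (simp add: sign_def)
    qed
    then show ?thesis by (simp add: card_permutations del: fact_Suc)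
  qed
  have last: "permute_list (?T (Suc p)) (t @ [v]) = t @ [v]" by simp
  \<comment> \<open>Coset decomposition: a permutation of \<open>p + 2\<close> positions is uniquely
    a transposition of the last position with some \<open>b\<close>, trivial when
    \<open>b = Suc p\<close>, followed by a permutation of the first \<open>p + 1\<close>
    positions.\<close>
  have "(\<Sum>\<pi> | \<pi> permutes insert (Suc p) {..<Suc p}. of_int (sign \<pi>) * ?a (permute_list \<pi> (t @ [v]))) =
    (\<Sum>b\<in>insert (Suc p) {..<Suc p}. \<Sum>\<rho>\<in>?Q.
      of_int (sign (?T b \<circ> \<rho>)) * ?a (permute_list (?T b \<circ> \<rho>) (t @ [v])))"
    by (rule sum_over_permutations_insert) auto
  also have "\<dots> = (\<Sum>\<rho>\<in>?Q. of_int (sign (?T (Suc p) \<circ> \<rho>)) * ?a (permute_list (?T (Suc p) \<circ> \<rho>) (t @ [v])))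
    + (\<Sum>b<Suc p. \<Sum>\<rho>\<in>?Q. of_int (sign (?T b \<circ> \<rho>)) * ?a (permute_list (?T b \<circ> \<rho>) (t @ [v])))"
    by (rule sum.insert) auto
  \<comment> \<open>For \<open>b = Suc p\<close> the transposition is the identity, with sign 1;
    every other \<open>b\<close> gives an odd one, hence the minus sign in the exchange
    terms.\<close>
  also have "\<dots> = fact (Suc p) * (f t / sqrt (dg t))
    + (\<Sum>b<Suc p. fact (Suc p) * - (f (t[b := v]) / sqrt (dg (t[b := v]))))"
  proof (rule arg_cong2[where f = "(+)"])
    show "(\<Sum>\<rho>\<in>?Q. of_int (sign (?T (Suc p) \<circ> \<rho>)) * ?a (permute_list (?T (Suc p) \<circ> \<rho>) (t @ [v])))
      = fact (Suc p) * (f t / sqrt (dg t))"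
      using inner[OF last] t by (simp add: snoc_in_Y_iff sign_id)
    show "(\<Sum>b<Suc p. \<Sum>\<rho>\<in>?Q. of_int (sign (?T b \<circ> \<rho>)) * ?a (permute_list (?T b \<circ> \<rho>) (t @ [v]))) =
      (\<Sum>b<Suc p. fact (Suc p) * - (f (t[b := v]) / sqrt (dg (t[b := v]))))"
    proof (rule sum.cong)
      fix b assume "b \<in> {..<Suc p}"
      then have b: "b < Suc p" by simp
      have "permute_list (?T b) (t @ [v]) = t[b := v] @ [t ! b]"
        using permute_list_transpose_last[of b t v] b len by simp
      from inner[OF this exchange_in_Y[OF t b]]
      show "(\<Sum>\<rho>\<in>?Q. of_int (sign (?T b \<circ> \<rho>)) * ?a (permute_list (?T b \<circ> \<rho>) (t @ [v]))) =
        fact (Suc p) * - (f (t[b := v]) / sqrt (dg (t[b := v])))"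
        using b by (simp add: sign_swap_id)
    qed simp
  qed
  also have "\<dots> = fact (Suc p) *
    (f t / sqrt (dg t) - (\<Sum>j<Suc p. f (t[j := v]) / sqrt (dg (t[j := v]))))"
    by (simp only: sum_distrib_left[symmetric] sum_negf distrib_left[symmetric]) simp
  finally have sum: "(\<Sum>\<pi> | \<pi> permutes {..<Suc p + 1}. of_int (sign \<pi>) * ?a (permute_list \<pi> (t @ [v]))) =
    fact (Suc p) * (f t / sqrt (dg t) - (\<Sum>j<Suc p. f (t[j := v]) / sqrt (dg (t[j := v]))))"
    by (simp only: lessThan_Suc[symmetric] Suc_eq_plus1[symmetric])
  \<comment> \<open>The common factor \<open>fact (Suc p)\<close> cancels against the normalisation
    and leaves \<open>1 / (p + 2)\<close>.\<close>
  have "fact (Suc p + 1) = (complex_of_real (real p + 2)) * fact (Suc p)"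
    by (simp add: algebra_simps)
  moreover have "(fact (Suc p) :: complex) \<noteq> 0" by (rule fact_nonzero)
  moreover have "t @ [v] \<in> Y" using t by (simp add: snoc_in_Y_iff)
  ultimately show ?thesis
    unfolding antisymmetrizer_def sum by simp
qed

section \<open>The up discriminant\<close>

lemma symmetric_lift:
  assumes "f \<in> even_cochains S p" "t \<in> X" "\<pi> permutes {..<Suc p}"
  shows "lift_ordered S p f (permute_list \<pi> t) = lift_ordered S p f t"
proof -
  have "orient t \<in> oriented_simplices S p"
    using assms(2) by (auto simp: oriented_simplices_def)
  then have "f (flip b (orient t)) = f (orient t)" for b
    using assms(1) by (simp add: even_cochains_def flip_def)
  then show ?thesis
    using assms(2,3) orient_permute[of t \<pi>] permute_in_X[OF assms(2,3)]
    by (simp add: lift_ordered_def ordered_simplices_iff)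
qed

lemma cochain_flip:
  assumes "f \<in> cochains S p" "t \<in> X"
  shows "f (flip b (orient t)) = (if b then - 1 else 1) * f (orient t)"
proof -
  have "orient t \<in> oriented_simplices S p"
    using assms(2) by (auto simp: oriented_simplices_def)
  then show ?thesis
    using assms(1) by (simp add: cochains_def flip_def)
qed

lemma antisymmetric_lift:
  assumes "f \<in> cochains S p" "t \<in> X" "\<pi> permutes {..<Suc p}"
  shows "lift_ordered S p f (permute_list \<pi> t) = of_int (sign \<pi>) * lift_ordered S p f t"
  using assms(2,3) orient_permute[of t \<pi>] permute_in_X[OF assms(2,3)]
    cochain_flip[OF assms(1,2)]
  by (simp add: lift_ordered_def ordered_simplices_iff sign_def)

lemma lift_ell2:
  assumes "f \<in> ell2 (oriented_simplices S p)"
  shows "lift_ordered S p f \<in> ell2 X"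
proof (rule ell2I)
  have "orient ` X \<subseteq> oriented_simplices S p" by (auto simp: oriented_simplices_def)
  then have "(\<lambda>t. (cmod (f (orient t)))\<^sup>2) summable_on X"
  proof (rule summable_on_finite_fibers[OF ell2_summable[OF assms], rotated])
    fix \<tau> :: "'a oriented" assume "\<tau> \<in> oriented_simplices S p"
    then obtain s b where s: "s \<in> X" "\<tau> = flip b (orient s)"
      using oriented_simplices_iff by blast
    \<comment> \<open>Orderings with the same orientation list the same vertices, so each fibre of
      \<open>orient\<close> sits in a set of \<open>fact (Suc p)\<close> lists.\<close>
    have "{t \<in> X. orient t = \<tau>} \<subseteq> permutations_of_set (set s)"
    proof
      fix t assume "t \<in> {t \<in> X. orient t = \<tau>}"
      then have t: "distinct t" "fst (orient t) = fst \<tau>" by (auto simp: ordered_simplices_iff)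
      then show "t \<in> permutations_of_set (set s)" using s by (simp add: permutations_of_set_def)
    qed
    moreover have "card (permutations_of_set (set s)) = fact (Suc p)"
      using s(1) distinct_card[of s] by (simp add: ordered_simplices_iff)
    ultimately show "finite {t \<in> X. orient t = \<tau>} \<and> card {t \<in> X. orient t = \<tau>} \<le> fact (Suc p)"
      using card_mono[of "permutations_of_set (set s)"] finite_subset[of _ "permutations_of_set (set s)"]
      by fastforce
  qed auto
  then show "(\<lambda>t. (cmod (lift_ordered S p f t))\<^sup>2) summable_on X"
    by (simp add: lift_ordered_def cong: summable_on_cong)
qed (simp add: lift_ordered_def)

text \<open>Square summability descends from ordered to oriented simplices, a converse of
  \<open>lift_ell2\<close> for antisymmetric functions. This lets a cochain inherit it from its
  lift.\<close>

lemma cochainI: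
  assumes "\<And>\<tau>. \<tau> \<notin> oriented_simplices S p \<Longrightarrow> f \<tau> = 0"
    and anti: "\<And>t b. t \<in> X \<Longrightarrow> f (flip b (orient t)) = (if b then - 1 else 1) * f (orient t)"
    and ell2: "lift_ordered S p f \<in> ell2 X"
  shows "f \<in> cochains S p"
proof -
  have opp: "f (opposite_orientation \<tau>) = - f \<tau>" if \<tau>: "\<tau> \<in> oriented_simplices S p" for \<tau>
  proof -
    obtain t b where t: "t \<in> X" "\<tau> = flip b (orient t)"
      using \<tau> oriented_simplices_iff by blast
    then have "opposite_orientation \<tau> = flip (\<not> b) (orient t)"
      by (simp add: flip_opposite ordered_simplices_iff)
    then show ?thesis using anti[OF t(1), of b] anti[OF t(1), of "\<not> b"] t(2) by auto
  qed
  let ?g = "\<lambda>\<tau>. (cmod (f \<tau>))\<^sup>2"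
  \<comment> \<open>\<open>B\<close> holds one ordering for each class in the image of
    \<open>orient\<close>, so sums over that image become sums over a subset of
    \<open>X\<close>.\<close>
  obtain B where B: "B \<subseteq> X" "inj_on orient B" "orient ` X = orient ` B"
    using subset_image_inj[of "orient ` X" orient X] by auto
  have "(\<lambda>t. (cmod (lift_ordered S p f t))\<^sup>2) summable_on B"
    by (rule summable_on_subset[OF ell2_summable[OF ell2] B(1)])
  then have "(\<lambda>t. ?g (orient t)) summable_on B"
    using B(1) by (auto simp: lift_ordered_def subset_iff cong: summable_on_cong)
  then have 1: "?g summable_on orient ` X"
    using B by (simp add: summable_on_reindex o_def)
  \<comment> \<open>The opposite classes are treated separately, since for \<open>p = 0\<close> they
    are not classes of any list. Complementation is its own inverse here and preserves the modulus
    of \<open>f\<close>.\<close>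
  have "inj_on opposite_orientation (orient ` X)"
    by (rule inj_on_inverseI[of _ opposite_orientation])
      (auto simp: opposite_opposite ordered_simplices_iff)
  moreover have "(\<lambda>\<tau>. ?g (opposite_orientation \<tau>)) summable_on orient ` X"
    using 1 opp by (simp add: oriented_simplices_def cong: summable_on_cong)
  ultimately have "?g summable_on opposite_orientation ` orient ` X"
    by (simp add: summable_on_reindex o_def)
  then have "?g summable_on oriented_simplices S p"
    unfolding oriented_simplices_def by (rule summable_on_union[OF 1])
  then show ?thesis
    using assms(1) opp by (auto simp: cochains_def intro: ell2I)
qed

section \<open>Up neighbours as exchanges of one vertex\<close>

lemma insert_link_in_simplices:
  assumes "t \<in> X"
  shows "{H \<in> simplices S (int p + 1). set t \<subseteq> H} = (\<lambda>v. insert v (set t)) ` link t"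
proof (intro equalityI subsetI)
  have t: "length t = Suc p" "card (set t) = Suc p"
    using assms distinct_card[of t] by (auto simp: ordered_simplices_iff)
  fix H
  show "H \<in> (\<lambda>v. insert v (set t)) ` link t" if H: "H \<in> {H \<in> simplices S (int p + 1). set t \<subseteq> H}"
  proof -
    have "card H = Suc (Suc p)" "H \<in> S" "set t \<subseteq> H"
      using H by (auto simp: simplices_def simplex_dim_def)
    moreover from this have "card (H - set t) = 1"
      using t by (subst card_Diff_subset) auto
    then obtain v where v: "H - set t = {v}" by (rule card_1_singletonE)
    ultimately have H: "H = insert v (set t)" by blast
    then have "v \<in> link t" using v \<open>H \<in> S\<close> by (auto simp: link_def)
    then show ?thesis using H by blast
  qed
  show "H \<in> {H \<in> simplices S (int p + 1). set t \<subseteq> H}" if "H \<in> (\<lambda>v. insert v (set t)) ` link t"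
    using that t by (auto simp: link_def simplices_def simplex_dim_def)
qed

lemma up_degree_eq:
  assumes "t \<in> X"
  shows "up_degree S p (flip b (orient t)) = dg t"
  using assms
  by (simp add: up_degree_def insert_link_in_simplices degree_eq)
    (rule card_image, auto simp: inj_on_def link_def)

lemma exchange:
  assumes "t \<in> X" "v \<in> link t" "j < Suc p"
  shows "t[j := v] \<in> X" "set (t[j := v]) = insert v (set t) - {t ! j}"
    "t ! j \<in> set t" "v \<notin> set t" "insert (t ! j) (set (t[j := v])) = insert v (set t)"
proof -
  show "t[j := v] \<in> X" using exchange_in_Y[OF assms] snoc_in_Y_iff by blast
  show 1: "t ! j \<in> set t" "v \<notin> set t" using assms by (auto simp: ordered_simplices_iff link_def)
  show 2: "set (t[j := v]) = insert v (set t) - {t ! j}"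
    using assms 1 set_update_distinct[of t j v] by (auto simp: ordered_simplices_iff)
  show "insert (t ! j) (set (t[j := v])) = insert v (set t)" using 1 2 by auto
qed

text \<open>An up neighbour lies in some \<open>insert v (set t)\<close> and, being different from
  \<open>t\<close> as a set, omits exactly one vertex \<open>t ! j\<close> of \<open>t\<close>. As a
  set it is then the exchanged simplex, and the bit \<open>b\<close> records its
  orientation.\<close>

lemma up_edges_eq:
  assumes t: "t \<in> X"
  shows "{\<tau>. (flip c (orient t), \<tau>) \<in> up_edges S p} =
    (\<lambda>(v, j, b). flip b (orient (t[j := v]))) ` (link t \<times> {..<Suc p} \<times> UNIV)" (is "?L = ?R")
proof (intro equalityI subsetI)
  have dist: "distinct t" and card_t: "card (set t) = Suc p"
    using t distinct_card[of t] by (auto simp: ordered_simplices_iff)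
  fix \<tau>
  show "\<tau> \<in> ?R" if L: "\<tau> \<in> ?L"
  proof -
    have \<tau>: "\<tau> \<in> oriented_simplices S p" "flip c (orient t) \<noteq> \<tau>"
      "flip c (orient t) \<noteq> opposite_orientation \<tau>"
      using L by (auto simp: up_edges_def)
    obtain H where H: "H \<in> simplices S (int p + 1)" "set t \<subseteq> H" "fst \<tau> \<subseteq> H"
      using L by (auto simp: up_edges_def up_neighbors_def)
    then obtain v where v: "H = insert v (set t)" "v \<in> link t"
      using insert_link_in_simplices[OF t] by blast
    obtain s d where s: "s \<in> X" "\<tau> = flip d (orient s)"
      using \<tau>(1) oriented_simplices_iff by blast
    have card_s: "card (set s) = Suc p"
      using s distinct_card[of s] by (auto simp: ordered_simplices_iff)
    \<comment> \<open>The two excluded values of \<open>\<tau>\<close> are exactly the two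
      orientations of \<open>set t\<close>.\<close>
    have "set t \<noteq> fst \<tau>"
    proof
      assume "set t = fst \<tau>"
      then obtain b where b: "\<tau> = flip b (orient t)"
        using oriented_simplex_cases[OF \<tau>(1) dist] by blast
      then show False
        using \<tau>(2,3) flip_opposite[OF dist, of b] by (cases "b = c") (auto simp: neq_iff)
    qed
    then have "\<not> set t \<subseteq> set s"
      using card_s card_t s(2) card_subset_eq[of "set s" "set t"] by auto
    then obtain x where x: "x \<in> set t" "x \<notin> set s" by blast
    then obtain j where j: "j < Suc p" "x = t ! j"
      using t by (auto simp: in_set_conv_nth ordered_simplices_iff)
    have "set s \<subseteq> set (t[j := v])"
      using H(3) x j v s(2) exchange(2)[OF t v(2) j(1)] by auto
    moreover have "card (set (t[j := v])) = Suc p"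
      using exchange(1)[OF t v(2) j(1)] distinct_card[of "t[j := v]"]
      by (simp add: ordered_simplices_iff)
    ultimately have "set (t[j := v]) = fst \<tau>"
      using card_s s(2) card_subset_eq[of "set (t[j := v])" "set s"] by simp
    then obtain b where "\<tau> = flip b (orient (t[j := v]))"
      using oriented_simplex_cases[OF \<tau>(1)] exchange(1)[OF t v(2) j(1)]
      by (auto simp: ordered_simplices_iff)
    then show ?thesis using v(2) j(1) by force
  qed
  show "\<tau> \<in> ?L" if R: "\<tau> \<in> ?R"
  proof -
    obtain v j b where *: "v \<in> link t" "j < Suc p" "\<tau> = flip b (orient (t[j := v]))"
      using R by auto
    note ex = exchange[OF t *(1,2)]
    have "fst \<tau> \<noteq> set t" using ex *(3) by auto
    then have "fst (flip c (orient t)) \<noteq> fst \<tau>"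
      "fst (flip c (orient t)) \<noteq> fst (opposite_orientation \<tau>)" by auto
    then have "flip c (orient t) \<noteq> \<tau>" "flip c (orient t) \<noteq> opposite_orientation \<tau>"
      by metis+
    moreover have "insert v (set t) \<in> simplices S (int p + 1)"
      using insert_link_in_simplices[OF t] *(1) by blast
    then have "up_neighbors S p (set t) (fst \<tau>)"
      unfolding up_neighbors_def using ex *(3) by (intro bexI[of _ "insert v (set t)"]) auto
    moreover have "\<tau> \<in> oriented_simplices S p" "flip c (orient t) \<in> oriented_simplices S p"
      using oriented_simplices_iff ex(1) t *(3) by blast+
    ultimately show ?thesis by (simp add: up_edges_def)
  qed
qed

text \<open>From the vertex set alone, \<open>v\<close> is recovered as its only element outside
  \<open>set t\<close>, and \<open>t ! j\<close> as the only element of \<open>set t\<close> missing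
  from it; the orientation then gives \<open>b\<close>. The sum over \<open>up_edges\<close> thus
  becomes a sum over triples.\<close>

lemma exchange_inj:
  assumes t: "t \<in> X"
  shows "inj_on (\<lambda>(v, j, b). flip b (orient (t[j := v]))) (link t \<times> {..<Suc p} \<times> UNIV)"
proof (rule inj_onI)
  fix x y
  assume xy: "x \<in> link t \<times> {..<Suc p} \<times> (UNIV :: bool set)" "y \<in> link t \<times> {..<Suc p} \<times> (UNIV :: bool set)"
    "(case x of (v, j, b) \<Rightarrow> flip b (orient (t[j := v]))) =
      (case y of (v, j, b) \<Rightarrow> flip b (orient (t[j := v])))"
  obtain v j b v' j' b' where x: "x = (v, j, b)" and y: "y = (v', j', b')"
    by (cases x; cases y) auto
  have v: "v \<in> link t" "v' \<in> link t" and j: "j \<in> {..<Suc p}" "j' \<in> {..<Suc p}"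
    and eq: "flip b (orient (t[j := v])) = flip b' (orient (t[j' := v']))"
    using xy x y by auto
  have "fst (flip b (orient (t[j := v]))) = fst (flip b' (orient (t[j' := v'])))"
    using eq by simp
  then have sets: "insert v (set t) - {t ! j} = insert v' (set t) - {t ! j'}"
    using exchange(2)[OF t] v j by simp
  have mem: "t ! j \<in> set t" "t ! j' \<in> set t" "v \<notin> set t" "v' \<notin> set t"
    using exchange(3,4)[OF t] v j by auto
  have "v = v'" using sets mem by blast
  moreover have "t ! j = t ! j'" using sets mem by blast
  then have "j = j'"
    using t j by (simp add: ordered_simplices_iff nth_eq_iff_index_eq)
  ultimately show "x = y" using eq x y by (simp add: flip_eq_iff)
qed

text \<open>Placing the omitted vertex last for both faces gives opposite orderings of the common
  simplex. The two powers of -1 multiply to 1, and the orientation bit of the selected simplex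
  enters both factors and cancels.\<close>

lemma up_sign_eq:
  assumes t: "t \<in> X" "v \<in> link t" "j < Suc p"
  shows "up_sign S p (flip c (orient t)) (flip b (orient (t[j := v]))) = (if b = c then - 1 else 1)"
proof -
  note ex = exchange[OF t]
  let ?\<tau> = "flip c (orient t)" and ?\<tau>' = "flip b (orient (t[j := v]))"
  let ?P = "\<lambda>\<sigma>. \<sigma> \<in> oriented_simplices S (Suc p) \<and> fst ?\<tau> \<subseteq> fst \<sigma> \<and> fst ?\<tau>' \<subseteq> fst \<sigma>"
  have tv: "t @ [v] \<in> Y" using t by (simp add: snoc_in_Y_iff)
  then have dist: "distinct (t @ [v])" by (simp add: ordered_simplices_iff)
  have dist': "distinct (t[j := v] @ [t ! j])"
    using exchange_in_Y[OF t] by (simp add: ordered_simplices_iff)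
  have len: "length t = Suc p" using t by (simp add: ordered_simplices_iff)
  have "?P (flip False (orient (t @ [v])))"
    using tv ex oriented_simplices_iff by (auto simp: oriented_simplices_def)
  then have \<sigma>: "?P (SOME \<sigma>. ?P \<sigma>)" by (rule someI)
  define \<sigma> where "\<sigma> = (SOME \<sigma>. ?P \<sigma>)"
  have P: "\<sigma> \<in> oriented_simplices S (Suc p)" "set t \<subseteq> fst \<sigma>" "set (t[j := v]) \<subseteq> fst \<sigma>"
    using \<sigma> unfolding \<sigma>_def by auto
  obtain s d where s: "s \<in> Y" "\<sigma> = flip d (orient s)"
    using P(1) oriented_simplices_iff by blast
  \<comment> \<open>Containing both faces forces the selected simplex to be an orientation of
    \<open>t @ [v]\<close>, whichever one \<open>SOME\<close> returns.\<close>
  have "set (t @ [v]) \<subseteq> fst \<sigma>" using P(2,3) ex by auto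
  moreover have "card (set (t @ [v])) = card (fst \<sigma>)"
    using s tv distinct_card[of s] distinct_card[of "t @ [v]"] by (simp add: ordered_simplices_iff)
  ultimately have "set (t @ [v]) = fst \<sigma>"
    using s by (intro card_subset_eq) auto
  then obtain e where e: "\<sigma> = flip e (orient (t @ [v]))"
    using oriented_simplex_cases[OF P(1) dist] by blast
  then have e': "\<sigma> = flip (\<not> e) (orient (t[j := v] @ [t ! j]))"
    using orient_exchange[OF dist, of j] flip_flip[OF dist, of "\<not> e" True] t(3) len by simp
  have "incidence_sign \<sigma> ?\<tau> = (if e = c then 1 else -1) * (-1) ^ Suc p"
    using incidence_sign_snoc[OF dist, of e c] e len by simp
  moreover have "incidence_sign \<sigma> ?\<tau>' = (if (\<not> e) = b then 1 else -1) * (-1) ^ Suc p"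
    using incidence_sign_snoc[OF dist', of "\<not> e" b] e' len by simp
  moreover have "(-1) ^ Suc p * (-1) ^ Suc p = (1 :: int)"
    by (simp flip: power_add add: mult_2[symmetric])
  moreover have "up_sign S p ?\<tau> ?\<tau>' = incidence_sign \<sigma> ?\<tau> * incidence_sign \<sigma> ?\<tau>'"
    by (simp add: up_sign_def \<sigma>_def Let_def)
  ultimately show ?thesis by (cases e; cases b; cases c) auto
qed

text \<open>The two orientations of each exchanged simplex contribute equally, since sign and
  cochain both change under a flip; the resulting factor 2 turns the denominator
  \<open>2 * (p + 1)\<close> into \<open>p + 1\<close>. The dependence on \<open>c\<close> shows
  that antisymmetry is preserved.\<close>

lemma up_discriminant_eq:
  assumes f: "f \<in> cochains S p" and t: "t \<in> X"
  shows "up_discriminant S p f (flip c (orient t)) = (if c then 1 else - 1) *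
    (\<Sum>v\<in>link t. \<Sum>j<Suc p. f (orient (t[j := v])) / (sqrt (dg t) * sqrt (dg (t[j := v])))) /
    (real p + 1)"
proof -
  let ?I = "link t \<times> {..<Suc p} \<times> (UNIV :: bool set)"
  let ?n = "2 * (real p + 1)"
  let ?F = "\<lambda>\<tau>'. of_int (up_sign S p (flip c (orient t)) \<tau>') * f \<tau>' /
     of_real (sqrt (?n * real (up_degree S p (flip c (orient t)))) *
              sqrt (?n * real (up_degree S p \<tau>')))"
  let ?h = "\<lambda>v j. f (orient (t[j := v])) / (sqrt (dg t) * sqrt (dg (t[j := v])))"
  have double_half: "2 * (a / (2 * b)) = a / b" for a b :: complex by simp
  have summand: "?F (flip b (orient (t[j := v]))) = (if c then 1 else - 1) * ?h v j / ?n"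
    if "v \<in> link t" "j < Suc p" for v j b
  proof -
    have ex: "t[j := v] \<in> X" using exchange(1)[OF t that] .
    have "sqrt (?n * real (dg t)) * sqrt (?n * real (dg (t[j := v]))) =
        ?n * (sqrt (dg t) * sqrt (dg (t[j := v])))"
      by (simp add: real_sqrt_mult)
    then show ?thesis
      using ex t that
      by (simp only: up_degree_eq up_sign_eq cochain_flip[OF f ex]) (auto simp: mult_ac)
  qed
  have "up_discriminant S p f (flip c (orient t)) =
      (\<Sum>\<tau>'\<in>(\<lambda>(v, j, b). flip b (orient (t[j := v]))) ` ?I. ?F \<tau>')"
    by (simp only: up_discriminant_def up_edges_eq[OF t])
  also have "\<dots> = (\<Sum>(v, j, b)\<in>?I. ?F (flip b (orient (t[j := v]))))"
    by (subst sum.reindex[OF exchange_inj[OF t]]) (simp add: case_prod_unfold)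
  also have "\<dots> = (\<Sum>v\<in>link t. \<Sum>j<Suc p. \<Sum>b\<in>UNIV. ?F (flip b (orient (t[j := v]))))"
    by (simp only: sum.cartesian_product)
  also have "\<dots> = (\<Sum>v\<in>link t. \<Sum>j<Suc p. (if c then 1 else - 1) * ?h v j / (real p + 1))"
  proof (intro sum.cong refl)
    fix v j assume "v \<in> link t" "j \<in> {..<Suc p}"
    then have "(\<Sum>b\<in>UNIV. ?F (flip b (orient (t[j := v])))) =
        (\<Sum>b\<in>(UNIV :: bool set). (if c then 1 else - 1) * ?h v j / ?n)"
      using summand by (intro sum.cong) auto
    also have "\<dots> = 2 * ((if c then 1 else - 1) * ?h v j / ?n)"
      by (simp only: sum_constant card_UNIV_bool of_nat_numeral)
    also have "\<dots> = (if c then 1 else - 1) * ?h v j / (real p + 1)"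
      unfolding of_real_mult of_real_numeral by (rule double_half)
    finally show "(\<Sum>b\<in>UNIV. ?F (flip b (orient (t[j := v])))) =
        (if c then 1 else - 1) * ?h v j / (real p + 1)" .
  qed
  also have "\<dots> = (if c then 1 else - 1) * (\<Sum>v\<in>link t. \<Sum>j<Suc p. ?h v j) / (real p + 1)"
    by (simp only: sum_distrib_left sum_divide_distrib)
  finally show ?thesis .
qed

section \<open>Comparison of the two discriminants\<close>

lemma up_discriminant_outside:
  "\<tau> \<notin> oriented_simplices S p \<Longrightarrow> up_discriminant S p f \<tau> = 0"
  by (simp add: up_discriminant_def up_edges_def)

lemma walk_discriminant_even:
  assumes "1 \<le> p" "f \<in> even_cochains S p"
  shows "walk_discriminant S (Suc p) (lift_ordered S p f) = - lift_ordered S p f"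
proof -
  have f: "lift_ordered S p f \<in> ell2 X"
    using assms(2) by (intro lift_ell2) (simp add: even_cochains_def)
  have "antisymmetrizer S (Suc p) (walk_alpha S p (lift_ordered S p f)) s = 0" for s
    using assms by (intro antisymmetrizer_alpha_symmetric symmetric_lift)
  then show ?thesis
    by (simp add: walk_discriminant_eq(1)[OF f] fun_eq_iff) (simp add: lift_ordered_def)
qed

lemma cochain_lift_ell2: "f \<in> cochains S p \<Longrightarrow> lift_ordered S p f \<in> ell2 X"
  by (rule lift_ell2) (simp add: cochains_def)

text \<open>Apart from the factor \<open>1 / (p + 2)\<close>, dividing by \<open>sqrt (dg t)\<close>
  and summing over the link turns the first term into \<open>f (orient t)\<close> and the others
  into the exchange sum \<open>?\<Sigma>\<close>, which is \<open>-(p + 1)\<close> times the value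
  of the up discriminant.\<close>

lemma walk_discriminant_cochain:
  assumes f: "f \<in> cochains S p"
  shows "lift_ordered S p f - walk_discriminant S (Suc p) (lift_ordered S p f) =
    (\<lambda>s. of_real (2 * (real p + 1) / (real p + 2)) *
      lift_ordered S p (f - up_discriminant S p f) s)"
proof
  fix t
  let ?f = "lift_ordered S p f"
  show "(?f - walk_discriminant S (Suc p) ?f) t = of_real (2 * (real p + 1) / (real p + 2)) *
      lift_ordered S p (f - up_discriminant S p f) t"
  proof (cases "t \<in> X")
    case False
    then show ?thesis
      by (simp add: walk_discriminant_eq(1)[OF cochain_lift_ell2[OF f]]) (simp add: lift_ordered_def)
  next
    case True
    let ?\<Sigma> = "\<Sum>v\<in>link t. \<Sum>j<Suc p. f (orient (t[j := v])) / (sqrt (dg t) * sqrt (dg (t[j := v])))"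
    have P: "antisymmetrizer S (Suc p) (walk_alpha S p ?f) (t @ [v]) =
        (f (orient t) / sqrt (dg t) - (\<Sum>j<Suc p. f (orient (t[j := v])) / sqrt (dg (t[j := v])))) /
        (real p + 2)" if "v \<in> link t" for v
    proof -
      have "antisymmetrizer S (Suc p) (walk_alpha S p ?f) (t @ [v]) =
        (?f t / sqrt (dg t) - (\<Sum>j<Suc p. ?f (t[j := v]) / sqrt (dg (t[j := v])))) / (real p + 2)"
        by (rule antisymmetrizer_alpha_antisymmetric[OF _ True that]) (rule antisymmetric_lift[OF f])
      also have "(\<Sum>j<Suc p. ?f (t[j := v]) / sqrt (dg (t[j := v]))) =
          (\<Sum>j<Suc p. f (orient (t[j := v])) / sqrt (dg (t[j := v])))"
        using exchange(1)[OF True that] by (intro sum.cong) (simp_all add: lift_ordered_def)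
      also have "?f t = f (orient t)" using True by (simp add: lift_ordered_def)
      finally show ?thesis .
    qed
    have "(\<Sum>v\<in>link t. antisymmetrizer S (Suc p) (walk_alpha S p ?f) (t @ [v])) / sqrt (dg t) =
        (\<Sum>v\<in>link t. (f (orient t) / (sqrt (dg t) * sqrt (dg t)) -
          (\<Sum>j<Suc p. f (orient (t[j := v])) / (sqrt (dg t) * sqrt (dg (t[j := v]))))) / (real p + 2))"
      unfolding sum_divide_distrib[of _ "link t" "of_real (sqrt (dg t))"]
    proof (rule sum.cong[OF refl])
      fix v assume v: "v \<in> link t"
      show "antisymmetrizer S (Suc p) (walk_alpha S p ?f) (t @ [v]) / sqrt (dg t) =
        (f (orient t) / (sqrt (dg t) * sqrt (dg t)) -
          (\<Sum>j<Suc p. f (orient (t[j := v])) / (sqrt (dg t) * sqrt (dg (t[j := v]))))) / (real p + 2)"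
        unfolding P[OF v]
        by (simp only: diff_divide_distrib sum_divide_distrib divide_divide_eq_left of_real_mult mult_ac)
    qed
    also have "\<dots> = (dg t * (f (orient t) / (sqrt (dg t) * sqrt (dg t))) - ?\<Sigma>) / (real p + 2)"
      using True
      by (simp only: sum_divide_distrib[symmetric] sum_subtractf sum_constant degree_eq
          times_divide_eq_right)
    also have "dg t * (f (orient t) / (sqrt (dg t) * sqrt (dg t))) = f (orient t)"
      using degree_pos[OF True] by (simp add: of_real_sqrt_mult_self)
    finally have "walk_discriminant S (Suc p) ?f t =
        2 * ((f (orient t) - ?\<Sigma>) / (real p + 2)) - ?f t"
      using True
      by (simp only: walk_discriminant_eq(1)[OF cochain_lift_ell2[OF f]] if_True
          times_divide_eq_right[symmetric])
    then have D: "(?f - walk_discriminant S (Suc p) ?f) t =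
        f (orient t) - (2 * ((f (orient t) - ?\<Sigma>) / (real p + 2)) - f (orient t))"
      using True by (simp add: lift_ordered_def)
    have up: "lift_ordered S p (f - up_discriminant S p f) t = f (orient t) + ?\<Sigma> / (real p + 1)"
      using True up_discriminant_eq[OF f True, of False] by (simp add: lift_ordered_def)
    show ?thesis
      unfolding D up by (rule discriminant_identity) simp_all
  qed
qed

text \<open>Solving the identity for the walk discriminant names the cochain whose lift it is.
  Square summability of that cochain comes from the walk side through \<open>cochainI\<close>, so no
  separate estimate of the up discriminant is made.\<close>

lemma walk_discriminant_lift_cochain:
  assumes f: "f \<in> cochains S p"
  defines "k \<equiv> complex_of_real (2 * (real p + 1) / (real p + 2))"
  shows "(\<lambda>\<tau>. f \<tau> - k * (f \<tau> - up_discriminant S p f \<tau>)) \<in> cochains S p"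
    and "lift_ordered S p (\<lambda>\<tau>. f \<tau> - k * (f \<tau> - up_discriminant S p f \<tau>)) =
      walk_discriminant S (Suc p) (lift_ordered S p f)"
proof -
  let ?g = "\<lambda>\<tau>. f \<tau> - k * (f \<tau> - up_discriminant S p f \<tau>)"
  have eq: "lift_ordered S p f t - walk_discriminant S (Suc p) (lift_ordered S p f) t =
      k * lift_ordered S p (f - up_discriminant S p f) t" for t
    using fun_cong[OF walk_discriminant_cochain[OF f], of t] by (simp add: k_def)
  show lift: "lift_ordered S p ?g = walk_discriminant S (Suc p) (lift_ordered S p f)"
  proof
    fix t show "lift_ordered S p ?g t = walk_discriminant S (Suc p) (lift_ordered S p f) t"
    proof (cases "t \<in> X")
      case True
      then show ?thesis using eq[of t] by (simp add: lift_ordered_def algebra_simps)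
    next
      case False
      then show ?thesis
        by (simp add: walk_discriminant_eq(1)[OF cochain_lift_ell2[OF f]]) (simp add: lift_ordered_def)
    qed
  qed
  show "?g \<in> cochains S p"
  proof (rule cochainI)
    show "lift_ordered S p ?g \<in> ell2 X"
      unfolding lift by (rule walk_discriminant_eq(2)[OF cochain_lift_ell2[OF f]])
    show "?g \<tau> = 0" if "\<tau> \<notin> oriented_simplices S p" for \<tau>
    proof -
      have "f \<tau> = 0" using f that by (auto simp: cochains_def dest: ell2D)
      then show ?thesis using that by (simp add: up_discriminant_outside)
    qed
    show "?g (flip b (orient t)) = (if b then - 1 else 1) * ?g (orient t)" if "t \<in> X" for t b
      using up_discriminant_eq[OF f that, of b] up_discriminant_eq[OF f that, of False]
        cochain_flip[OF f that, of b]
      by (simp add: algebra_simps)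
  qed
qed

section \<open>Invariance of the space of lifted cochains\<close>

lemma complex_subspace_lift_cochains: "complex_subspace (lift_ordered S p ` cochains S p)"
proof (rule complex_subspaceI)
  have "(\<lambda>\<tau>. 0) \<in> cochains S p" by (simp add: cochains_def ell2_zero)
  then show "(\<lambda>x. 0) \<in> lift_ordered S p ` cochains S p"
    by (rule rev_image_eqI) (simp add: lift_ordered_def fun_eq_iff)
next
  fix f g assume "f \<in> lift_ordered S p ` cochains S p" "g \<in> lift_ordered S p ` cochains S p"
  then obtain f' g' where *: "f = lift_ordered S p f'" "g = lift_ordered S p g'"
    "f' \<in> cochains S p" "g' \<in> cochains S p" by blast
  then have "(\<lambda>\<tau>. f' \<tau> + g' \<tau>) \<in> cochains S p" by (simp add: cochains_def ell2_add)
  then show "(\<lambda>x. f x + g x) \<in> lift_ordered S p ` cochains S p"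
    by (rule rev_image_eqI) (simp add: * lift_ordered_def fun_eq_iff)
next
  fix c f assume "f \<in> lift_ordered S p ` cochains S p"
  then obtain f' where *: "f = lift_ordered S p f'" "f' \<in> cochains S p" by blast
  then have "(\<lambda>\<tau>. c * f' \<tau>) \<in> cochains S p" by (simp add: cochains_def ell2_scale)
  then show "(\<lambda>x. c * f x) \<in> lift_ordered S p ` cochains S p"
    by (rule rev_image_eqI) (simp add: * lift_ordered_def fun_eq_iff)
qed

lemma invariant_lift_cochains:
  "invariant_subspace (ell2 X) (walk_discriminant S (Suc p)) (lift_ordered S p ` cochains S p)"
  unfolding invariant_subspace_def
proof (intro conjI ballI)
  show "lift_ordered S p ` cochains S p \<subseteq> ell2 X" using cochain_lift_ell2 by blast
  fix g assume "g \<in> lift_ordered S p ` cochains S p"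
  then obtain f where f: "f \<in> cochains S p" and g: "g = lift_ordered S p f" by blast
  show "walk_discriminant S (Suc p) g \<in> lift_ordered S p ` cochains S p"
    unfolding g
    by (rule rev_image_eqI[OF walk_discriminant_lift_cochain(1)[OF f]])
      (rule walk_discriminant_lift_cochain(2)[OF f, symmetric])
qed (rule complex_subspace_lift_cochains)

end

theorem theorem4p7:
  fixes V :: "'a set" and S :: "'a set set" and q :: nat
  assumes "abstract_simplicial_complex V S"
    and "bounded_degree S"
    and "finite_dimensional S"
    and "pure S"
    and "strongly_connected S"
    and "1 \<le> q" and "int q \<le> complex_dim S"
  shows
    "(2 \<le> q \<longrightarrow>
       (\<forall>f\<in>even_cochains S (q - 1).
          walk_discriminant S q (lift_ordered S (q - 1) f) = - lift_ordered S (q - 1) f)) \<and>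
     invariant_subspace (ell2 (ordered_simplices S (q - 1))) (walk_discriminant S q)
       (lift_ordered S (q - 1) ` cochains S (q - 1)) \<and>
     (\<forall>f\<in>cochains S (q - 1).
        lift_ordered S (q - 1) f - walk_discriminant S q (lift_ordered S (q - 1) f) =
        (\<lambda>s. of_real (2 * real q / (real q + 1)) *
           lift_ordered S (q - 1) (f - up_discriminant S (q - 1) f) s))"
proof -
  define p where "p = q - 1"
  have q: "q = Suc p" using assms(6) by (simp add: p_def)
  have closed: "G \<in> S" if "F \<in> S" "G \<subseteq> F" for F G
    using assms(1) that unfolding abstract_simplicial_complex_def by blast
  interpret extendable_complex S p
  proof
    show "G \<in> S" if "F \<in> S" "G \<subseteq> F" for F G
      using that by (rule closed)
    show "bounded_degree S" by (rule assms(2))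
    fix F assume F: "F \<in> S" "card F = Suc p"
    then obtain G where G: "G \<in> S" "simplex_dim G = complex_dim S" "F \<subseteq> G"
      using assms(4) unfolding pure_def simplices_def by blast
    \<comment> \<open>A simplex \<open>G\<close> of top dimension over \<open>F\<close> has
      dimension at least \<open>q = p + 1\<close>, one more than \<open>F\<close>, so some vertex of
      \<open>G\<close> is left to extend \<open>F\<close>.\<close>
    have "card F < card G"
      using G(2) assms(7) F(2) q by (simp add: simplex_dim_def)
    then have "F \<noteq> G" by auto
    then obtain v where v: "v \<in> G" "v \<notin> F" using G(3) by blast
    have "insert v F \<in> S"
      using G(3) v(1) by (intro closed[OF G(1)]) simp
    then show "\<exists>v. v \<notin> F \<and> insert v F \<in> S" using v by blast
  qed
  have k: "2 * real (Suc p) / (real (Suc p) + 1) = 2 * (real p + 1) / (real p + 2)"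
    by (simp add: add.commute)
  show ?thesis
    unfolding q diff_Suc_1 k
  proof (intro conjI impI ballI)
    \<comment> \<open>At \<open>q = 1\<close> the lifts of symmetric and of antisymmetric functions
      form the same space, so this claim is confined to \<open>2 \<le> q\<close>.\<close>
    show "walk_discriminant S (Suc p) (lift_ordered S p f) = - lift_ordered S p f"
      if "2 \<le> Suc p" "f \<in> even_cochains S p" for f
      using that by (intro walk_discriminant_even) simp_all
  qed (rule invariant_lift_cochains, rule walk_discriminant_cochain)
qed

end
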